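(* Let $A=(a_{ij})\in\mathbf{RM}_7$ and $\xi_j=(|a_{j,j+1}|-|a_{j+1,j}|)^2/4$, $j=1,\dots,6$. Then $C(A)$ consists of three concentric ellipses and the point at the origin if and only if either (a) or (b) holds. (a) Both $$\xi_2^2-\xi_3^2-\xi_4^2-\xi_5^2-2\xi_6^2-6\xi_3\xi_2+2\xi_4\xi_2+2\xi_5\xi_2-2\xi_3\xi_4+6\xi_3\xi_5-2\xi_4\xi_5+4\xi_3\xi_6+4\xi_4\xi_6-4\xi_5\xi_6=0$$ and $\xi_1+\xi_2-\xi_5-\xi_6=0$. (b) $\xi_2+\xi_3=\xi_4+\xi_5$, and both of the following equations are satisfied: $$\begin{aligned}&\xi_1^3+3\xi_2\xi_1^2+4\xi_3\xi_1^2+4\xi_4\xi_1^2+3\xi_5\xi_1^2+3\xi_6\xi_1^2+\xi_2^2\xi_1+2\xi_3^2\xi_1+2\xi_4^2\xi_1+\xi_5^2\xi_1+3\xi_6^2\xi_1\\&+4\xi_2\xi_3\xi_1+4\xi_2\xi_4\xi_1+4\xi_3\xi_4\xi_1+2\xi_2\xi_5\xi_1-28\xi_3\xi_5\xi_1+4\xi_4\xi_5\xi_1+6\xi_2\xi_6\xi_1-24\xi_3\xi_6\xi_1-24\xi_4\xi_6\xi_1+6\xi_5\xi_6\xi_1\\&-\xi_2^3-\xi_5^3+\xi_6^3+2\xi_2\xi_3^2+2\xi_2\xi_4^2-3\xi_2\xi_5^2+3\xi_2\xi_6^2+4\xi_3\xi_6^2+4\xi_4\xi_6^2+3\xi_5\xi_6^2+4\xi_2\xi_3\xi_4-3\xi_2^2\xi_5+2\xi_3^2\xi_5+2\xi_4^2\xi_5\\&+4\xi_3\xi_4\xi_5+\xi_2^2\xi_6+2\xi_3^2\xi_6+2\xi_4^2\xi_6+\xi_5^2\xi_6+4\xi_2\xi_3\xi_6-28\xi_2\xi_4\xi_6+4\xi_3\xi_4\xi_6+2\xi_2\xi_5\xi_6+4\xi_3\xi_5\xi_6+4\xi_4\xi_5\xi_6=0,\end{aligned}$$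 $$\begin{aligned}&5\xi_1^2+10\xi_2\xi_1-4\xi_3\xi_1-4\xi_4\xi_1-6\xi_5\xi_1-6\xi_6\xi_1+3\xi_2^2+2\xi_3^2+2\xi_4^2+3\xi_5^2+5\xi_6^2+8\xi_2\xi_3-8\xi_2\xi_4\\&+4\xi_3\xi_4-10\xi_2\xi_5-8\xi_3\xi_5+8\xi_4\xi_5-6\xi_2\xi_6-4\xi_3\xi_6-4\xi_4\xi_6+10\xi_5\xi_6=0.\end{aligned}$$
   Context: $\mathbf{RM}_7$ is the set of complex $7\times 7$ tridiagonal matrices $A=(a_{ij})$ with zero main diagonal and $a_{i,i+1}a_{i+1,i}=1$ for $i=1,\dots,6$ (reciprocal matrices). For a square matrix $A$, $\operatorname{Re}A=(A+A^* )/2$; the Kippenhahn polynomial of $A$ is $P_A(\lambda,\theta)=\det(\operatorname{Re}(e^{i\theta}A)-\lambda I)$, and the Kippenhahn curve $C(A)$ is the envelope of the family of lines $\{e^{-i\theta}(\lambda_j(\theta)+i\mathbb R):\theta\in(-\pi,\pi],\ j=1,\dots,7\}$, where $\lambda_j(\theta)$ are the roots of $P_A(\cdot,\theta)$. The concentric ellipses are all centered at the origin.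
   Formalization: "Ellipse" here includes circles and the degenerate case of a pair of foci {f,-f} with f nonzero (minor axis zero); the three ellipses are pairwise distinct. Without degenerate ellipses the claim fails, e.g. when all |a_{j,j+1}|=1, where C(A) is seven points. *)

theory Defs
  imports Complex_Main "Jordan_Normal_Form.Schur_Decomposition"
begin

(* Matrix indices start at 0, so the entry usually written a_{j,k} is A $$ (j - 1, k - 1). *)
definition reciprocal_matrices :: "nat \<Rightarrow> complex mat set" where
  "reciprocal_matrices n = {A \<in> carrier_mat n n.
     (\<forall>i<n. A $$ (i, i) = 0) \<and>
     (\<forall>i<n. \<forall>j<n. A $$ (i, j) \<noteq> 0 \<longrightarrow> i = j \<or> j = i + 1 \<or> i = j + 1) \<and>
     (\<forall>i. i + 1 < n \<longrightarrow> A $$ (i, i + 1) * A $$ (i + 1, i) = 1)}"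

definition Re_mat :: "complex mat \<Rightarrow> complex mat" where
  "Re_mat A = (1 / 2) \<cdot>\<^sub>m (A + mat_adjoint A)"

definition kippenhahn_poly :: "complex mat \<Rightarrow> complex \<Rightarrow> real \<Rightarrow> complex" where
  "kippenhahn_poly A l \<theta> = det (Re_mat (cis \<theta> \<cdot>\<^sub>m A) - l \<cdot>\<^sub>m 1\<^sub>m (dim_row A))"

definition kippenhahn_line :: "real \<Rightarrow> real \<Rightarrow> complex set" where
  "kippenhahn_line \<theta> l = {cis (- \<theta>) * (complex_of_real l + \<i> * complex_of_real s) | s. True}"

lemma kippenhahn_line_iff: "z \<in> kippenhahn_line \<theta> l \<longleftrightarrow> Re (cis \<theta> * z) = l"
proof
  assume "z \<in> kippenhahn_line \<theta> l"
  then obtain s where z: "z = cis (- \<theta>) * (complex_of_real l + \<i> * complex_of_real s)"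
    by (auto simp: kippenhahn_line_def)
  have "cis \<theta> * z = complex_of_real l + \<i> * complex_of_real s"
    unfolding z mult.assoc[symmetric] cis_mult by simp
  then show "Re (cis \<theta> * z) = l" by simp
next
  assume l: "Re (cis \<theta> * z) = l"
  have "z = cis (- \<theta>) * (cis \<theta> * z)"
    unfolding mult.assoc[symmetric] cis_mult by simp
  also have "cis \<theta> * z = complex_of_real l + \<i> * complex_of_real (Im (cis \<theta> * z))"
    unfolding l[symmetric] by (rule complex_eq)
  finally show "z \<in> kippenhahn_line \<theta> l"
    unfolding kippenhahn_line_def by blast
qed

(* The eigenvalues may cross, and labelling them by size then destroys differentiability;
   the functions lambda_j are therefore the differentiable labellings of the roots near a
   given angle. *)
definition kippenhahn_branch :: "complex mat \<Rightarrow> (real \<Rightarrow> real) \<Rightarrow> real \<Rightarrow> bool" where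
  "kippenhahn_branch A f \<theta> \<longleftrightarrow>
     (\<forall>\<^sub>F t in nhds \<theta>. kippenhahn_poly A (complex_of_real (f t)) t = 0 \<and> f differentiable (at t))"

(* The line at angle t has the equation F t z = 0 with F t z = Re (cis t * z) - f t
   (see kippenhahn_line_iff); z lies on the envelope if, at some angle, both F and its
   derivative with respect to the angle vanish. *)
definition kippenhahn_curve :: "complex mat \<Rightarrow> complex set" where
  "kippenhahn_curve A = {z. \<exists>\<theta>\<in>{-pi<..pi}. \<exists>f. kippenhahn_branch A f \<theta> \<and>
     z \<in> kippenhahn_line \<theta> (f \<theta>) \<and>
     ((\<lambda>t. Re (cis t * z) - f t) has_real_derivative 0) (at \<theta>)}"

(* Ellipse with foci f, -f and major semi-axis a; circles have f = 0. When the minor axis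
   shrinks to 0, the tangent lines of the ellipse become the lines through one of the foci,
   whose envelope is the pair of foci and not the segment between them. *)
definition centered_ellipse :: "complex set \<Rightarrow> bool" where
  "centered_ellipse E \<longleftrightarrow>
     (\<exists>f a. cmod f < a \<and> E = {z. cmod (z - f) + cmod (z + f) = 2 * a}) \<or>
     (\<exists>f. f \<noteq> 0 \<and> E = {f, - f})"

definition three_ellipses_and_origin :: "complex set \<Rightarrow> bool" where
  "three_ellipses_and_origin C \<longleftrightarrow>
     (\<exists>E1 E2 E3. centered_ellipse E1 \<and> centered_ellipse E2 \<and> centered_ellipse E3 \<and>
        E1 \<noteq> E2 \<and> E1 \<noteq> E3 \<and> E2 \<noteq> E3 \<and> C = E1 \<union> E2 \<union> E3 \<union> {0})"

end

theory Submission
  imports Defs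
begin

text \<open>The squared moduli of the off-diagonal entries of \<open>Re (cis t * A)\<close> are \<open>\<xi> j + (cos t)^2\<close>, so the
  eigenvalues \<open>l\<close> are 0 and the roots of a cubic in \<open>l^2\<close> whose coefficients are polynomials in
  \<open>u = (cos t)^2\<close>. The top homogeneous part of this cubic in \<open>(l^2, u)\<close> has the roots \<open>2\<close> and
  \<open>2 \<plusminus> sqrt 2\<close>. A centered ellipse is the envelope of the lines with \<open>l^2 = \<alpha> * u + \<beta>\<close>, up to a
  rotation. Therefore the curve consists of three ellipses and the origin iff the cubic splits into
  three factors that are linear in \<open>u\<close>: their slopes must be \<open>2\<close>, \<open>2 \<plusminus> sqrt 2\<close>, the offsets are then
  determined, and comparing the remaining coefficients yields the equations.

  For the direction from the curve to the cubic, the three positive roots are smooth functions of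
  the angle near \<open>pi / 4\<close>. The envelope point of one of them stays in one ellipse on some
  interval, which makes the root a quadratic form in \<open>(cos t, sin t)\<close>.\<close>

text \<open>The slopes are the squares of the nonzero numbers 2 cos (k pi / 8), the eigenvalues of
  the path on seven vertices: the top homogeneous part is the cubic with all weights equal to 1.
  What carries the proof is that they are simple. Along a line with slope a, the coefficient of u^2
  is linear in the offset with a nonzero factor, so each slope admits only one offset, and three
  different roots that are linear in u have to use all three slopes. Of the six coefficients of
  degree at most 2 in (l^2, u), the three of degree 2 fix the offsets; the other three are the
  equations. The obstacle is that the curve is only a set of points. An envelope point may pass from
  one ellipse to another or stand still, and the ellipses may be tilted, so that a root first comes
  out as a quadratic form with a term in cos t * sin t. Shrinking to smaller open sets of angles
  loses nothing, because a polynomial identity in tan t or (cos t)^2 that holds on such a set holds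
  everywhere.\<close>

section \<open>The Kippenhahn polynomial of a reciprocal matrix\<close>

text \<open>The sums over the 1-, 2- and 3-matchings of a path with edge weights
  \<open>y 1, \<dots>, y 6\<close>: a tridiagonal matrix of size 7 with zero diagonal and \<open>y j\<close> as the products
  of its opposite off-diagonal entries has the characteristic polynomial \<open>l * kcubic y (l^2)\<close>.\<close>

definition path_e1 :: "(nat \<Rightarrow> real) \<Rightarrow> real" where
  "path_e1 y = y 1 + y 2 + y 3 + y 4 + y 5 + y 6"

definition path_e2 :: "(nat \<Rightarrow> real) \<Rightarrow> real" where
  "path_e2 y = y 1 * (y 3 + y 4 + y 5 + y 6) + y 2 * (y 4 + y 5 + y 6) + y 3 * (y 5 + y 6) + y 4 * y 6"

definition path_e3 :: "(nat \<Rightarrow> real) \<Rightarrow> real" where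
  "path_e3 y = y 1 * y 3 * y 5 + y 1 * y 3 * y 6 + y 1 * y 4 * y 6 + y 2 * y 4 * y 6"

definition kcubic :: "(nat \<Rightarrow> real) \<Rightarrow> real \<Rightarrow> real" where
  "kcubic y z = z^3 - path_e1 y * z^2 + path_e2 y * z - path_e3 y"

lemmas kcubic_unfold = kcubic_def path_e1_def path_e2_def path_e3_def

text \<open>Adding u to every edge weight expands a matching sum over submatchings. Each coefficient
  counts the ways to extend a given matching to one of the full size; in particular 6, 10 and 4 are
  the numbers of 1-, 2- and 3-matchings of the path.\<close>

lemma kcubic_shift:
  "kcubic (\<lambda>j. \<xi> j + u) z = z^3 - (path_e1 \<xi> + 6 * u) * z^2
     + (path_e2 \<xi> + (4 * \<xi> 1 + 3 * \<xi> 2 + 3 * \<xi> 3 + 3 * \<xi> 4 + 3 * \<xi> 5 + 4 * \<xi> 6) * u + 10 * u^2) * z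
     - (path_e3 \<xi> + (2 * \<xi> 1 * \<xi> 3 + \<xi> 1 * \<xi> 4 + \<xi> 1 * \<xi> 5 + 2 * \<xi> 1 * \<xi> 6 + \<xi> 2 * \<xi> 4 + \<xi> 2 * \<xi> 6
           + \<xi> 3 * \<xi> 5 + \<xi> 3 * \<xi> 6 + 2 * \<xi> 4 * \<xi> 6) * u
        + (3 * \<xi> 1 + \<xi> 2 + 2 * \<xi> 3 + 2 * \<xi> 4 + \<xi> 5 + 3 * \<xi> 6) * u^2 + 4 * u^3)"
  by (simp add: kcubic_unfold power2_eq_square power3_eq_cube algebra_simps)

section \<open>Determinants of tridiagonal matrices\<close>

definition tridiag :: "(nat \<Rightarrow> 'a) \<Rightarrow> (nat \<Rightarrow> 'a) \<Rightarrow> 'a \<Rightarrow> nat \<Rightarrow> 'a::comm_ring_1 mat" where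
  "tridiag b c d n = mat n n (\<lambda>(i, j).
     if i = j then d else if j = Suc i then b i else if i = Suc j then c j else 0)"

text \<open>The continuant recurrence: the last row has two nonzero entries, and the minor
  \<open>?B\<close> of the first of them has a single one in its last column.\<close>

lemma det_tridiag_Suc_Suc:
  "det (tridiag b c d (Suc (Suc n))) =
     d * det (tridiag b c d (Suc n)) - b n * c n * det (tridiag b c d n)"
proof -
  let ?T = "tridiag b c d"
  let ?A = "?T (Suc (Suc n))"
  let ?B = "mat_delete ?A (Suc n) n"
  have A: "?A \<in> carrier_mat (Suc (Suc n)) (Suc (Suc n))"
    by (simp add: tridiag_def)
  have B: "?B \<in> carrier_mat (Suc n) (Suc n)"
    by (auto simp: mat_delete_def tridiag_def)
  have del1: "mat_delete ?A (Suc n) (Suc n) = ?T (Suc n)"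
    by (rule eq_matI) (auto simp: mat_delete_def tridiag_def)
  have del2: "mat_delete ?B n n = ?T n"
    by (rule eq_matI) (auto simp: mat_delete_def tridiag_def)
  have "det ?B = (\<Sum>i<Suc n. ?B $$ (i, n) * cofactor ?B i n)"
    by (rule laplace_expansion_column[OF B]) simp
  also have "\<dots> = (\<Sum>i<n. ?B $$ (i, n) * cofactor ?B i n) + ?B $$ (n, n) * cofactor ?B n n"
    by simp
  also have "(\<Sum>i<n. ?B $$ (i, n) * cofactor ?B i n) = 0"
    by (rule sum.neutral) (auto simp: mat_delete_def tridiag_def)
  also have "?B $$ (n, n) = b n"
    by (simp add: mat_delete_def tridiag_def)
  also have "cofactor ?B n n = det (?T n)"
    unfolding cofactor_def del2 by simp
  finally have detB: "det ?B = b n * det (?T n)"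
    by simp
  have "det ?A = (\<Sum>j<Suc (Suc n). ?A $$ (Suc n, j) * cofactor ?A (Suc n) j)"
    by (rule laplace_expansion_row[OF A]) simp
  also have "\<dots> = (\<Sum>j<n. ?A $$ (Suc n, j) * cofactor ?A (Suc n) j)
      + ?A $$ (Suc n, n) * cofactor ?A (Suc n) n
      + ?A $$ (Suc n, Suc n) * cofactor ?A (Suc n) (Suc n)"
    by simp
  also have "(\<Sum>j<n. ?A $$ (Suc n, j) * cofactor ?A (Suc n) j) = 0"
    by (rule sum.neutral) (auto simp: tridiag_def)
  also have "cofactor ?A (Suc n) n = - det ?B"
    by (simp add: cofactor_def)
  also have "cofactor ?A (Suc n) (Suc n) = det (?T (Suc n))"
    by (simp add: cofactor_def del1)
  also have "?A $$ (Suc n, n) = c n"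
    by (simp add: tridiag_def)
  also have "?A $$ (Suc n, Suc n) = d"
    by (simp add: tridiag_def)
  finally show ?thesis
    by (simp add: detB algebra_simps)
qed

lemma det_tridiag_0: "det (tridiag b c d 0) = 1"
  by (simp add: tridiag_def)

lemma det_tridiag_1: "det (tridiag b c d (Suc 0)) = d"
  by (simp add: tridiag_def det_single)

lemma det_tridiag_7:
  assumes "\<And>j. j < 6 \<Longrightarrow> b j * c j = complex_of_real (y (Suc j))"
  shows "det (tridiag b c (- complex_of_real l) 7) = complex_of_real (- (l * kcubic y (l^2)))"
proof -
  let ?D = "\<lambda>n. det (tridiag b c (- complex_of_real l) n)"
  have step: "?D (Suc (Suc n)) = - complex_of_real l * ?D (Suc n) - complex_of_real (y (Suc n)) * ?D n"
    if "n < 6" for n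
    using assms[OF that] by (simp add: det_tridiag_Suc_Suc)
  have seven: "(7::nat) = Suc (Suc (Suc (Suc (Suc (Suc (Suc 0))))))"
    by simp
  have "?D 7 = ?D (Suc (Suc (Suc (Suc (Suc (Suc (Suc 0)))))))"
    by (subst seven) (rule refl)
  also have "\<dots> = complex_of_real (- (l * kcubic y (l^2)))"
    by (simp add: step det_tridiag_0 det_tridiag_1 kcubic_unfold eval_nat_numeral algebra_simps)
  finally show ?thesis .
qed

text \<open>For opposite entries u and v, the squared modulus of the entry of \<open>Re_mat\<close>
  is (|u|^2 + |v|^2 + 2 Re (e^(2it) u v)) / 4. Reciprocity enters twice: u v = 1 makes the last term
  2 cos (2t), whatever the arguments of u and v are, and |u| |v| = 1 makes |u|^2 + |v|^2 equal to 4
  \<xi> + 2.\<close>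

lemma kippenhahn_poly_reciprocal:
  fixes \<xi> :: "nat \<Rightarrow> real"
  assumes A: "A \<in> reciprocal_matrices 7"
    and \<xi>: "\<And>j. j \<in> {1..6} \<Longrightarrow> \<xi> j = (cmod (A $$ (j - 1, j)) - cmod (A $$ (j, j - 1)))^2 / 4"
  shows "kippenhahn_poly A (complex_of_real l) t =
    complex_of_real (- (l * kcubic (\<lambda>j. \<xi> j + (cos t)^2) (l^2)))"
proof -
  define b where "b i = (cis t * A $$ (i, Suc i) + cnj (cis t * A $$ (Suc i, i))) / 2" for i
  define c where "c i = cnj (b i)" for i
  have carr: "A \<in> carrier_mat 7 7" and zero: "\<And>i. i < 7 \<Longrightarrow> A $$ (i, i) = 0"
    and band: "\<And>i j. i < 7 \<Longrightarrow> j < 7 \<Longrightarrow> A $$ (i, j) \<noteq> 0 \<Longrightarrow> i = j \<or> j = i + 1 \<or> i = j + 1"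
    and recip: "\<And>i. i + 1 < 7 \<Longrightarrow> A $$ (i, i + 1) * A $$ (i + 1, i) = 1"
    using A unfolding reciprocal_matrices_def by blast+
  have dims: "dim_row A = 7" "dim_col A = 7"
    using carr by auto
  have entries: "Re_mat (cis t \<cdot>\<^sub>m A) - complex_of_real l \<cdot>\<^sub>m 1\<^sub>m (dim_row A)
      = tridiag b c (- complex_of_real l) 7" (is "?L = ?R")
  proof (rule eq_matI)
    fix i j assume "i < dim_row ?R" "j < dim_col ?R"
    then have ij: "i < 7" "j < 7" by (auto simp: tridiag_def)
    have off: "A $$ (i, j) = 0 \<and> A $$ (j, i) = 0" if "i \<noteq> j" "j \<noteq> Suc i" "i \<noteq> Suc j"
      using band[of i j] band[of j i] ij that by auto
    have "?L $$ (i, j) = (cis t * A $$ (i, j) + cnj (cis t * A $$ (j, i))) / 2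
        - (if i = j then complex_of_real l else 0)"
      using ij dims by (simp add: Re_mat_def mat_adjoint_def mat_of_rows_def)
    also have "\<dots> = ?R $$ (i, j)"
      using ij zero[of i] off by (auto simp: tridiag_def b_def c_def)
    finally show "?L $$ (i, j) = ?R $$ (i, j)" .
  qed (auto simp: tridiag_def Re_mat_def dims mat_adjoint_def)
  \<comment> \<open>Here x + iy is \<open>cis t\<close>, and p + iq and r + iw are the two opposite
    entries. The right side is grouped by the real and imaginary parts of their product, whose
    values 1 and 0 are then inserted.\<close>
  have id: "(x * p - y * q + (x * r - y * w))^2 + (x * q + y * p + (- (x * w) - y * r))^2
      = (x^2 + y^2) * (p^2 + q^2 + r^2 + w^2) + 2 * (x^2 - y^2) * (p * r - q * w)
        - 4 * (y * x) * (p * w + q * r)" for x y p q r w :: real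
    by (simp add: power2_eq_square algebra_simps)
  have "b j * c j = complex_of_real (\<xi> (Suc j) + (cos t)^2)" if j: "j < 6" for j
  proof -
    let ?u = "A $$ (j, Suc j)" and ?v = "A $$ (Suc j, j)"
    have uv: "?u * ?v = 1" using recip[of j] j by simp
    then have n: "cmod ?u * cmod ?v = 1"
      by (metis norm_mult norm_one)
    have re: "Re ?u * Re ?v - Im ?u * Im ?v = 1" and im: "Re ?u * Im ?v + Im ?u * Re ?v = 0"
      using uv by (auto simp: complex_eq_iff)
    have sc: "(sin t)^2 = 1 - (cos t)^2" by (simp add: sin_squared_eq)
    have "b j * c j = complex_of_real ((cmod (b j))^2)"
      unfolding c_def by (simp only: complex_norm_square)
    also have "(cmod (b j))^2 = (cmod ?u)^2 / 4 + (cmod ?v)^2 / 4 + ((cos t)^2 - 1/2) "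
    proof -
      have "4 * (cmod (b j))^2 = (cos t * Re ?u - sin t * Im ?u + (cos t * Re ?v - sin t * Im ?v))^2
         + (cos t * Im ?u + sin t * Re ?u + (- (cos t * Im ?v) - sin t * Re ?v))^2"
        by (simp add: b_def cmod_power2 power_divide)
      also have "\<dots> = ((cos t)^2 + (sin t)^2) * ((Re ?u)^2 + (Im ?u)^2 + (Re ?v)^2 + (Im ?v)^2)
         + 2 * ((cos t)^2 - (sin t)^2) * (Re ?u * Re ?v - Im ?u * Im ?v)
         - 4 * (sin t * cos t) * (Re ?u * Im ?v + Im ?u * Re ?v)"
        by (rule id)
      finally show ?thesis unfolding re im cmod_power2 sc by (simp add: field_simps)
    qed
    also have "(cmod ?u)^2 / 4 + (cmod ?v)^2 / 4 + ((cos t)^2 - 1/2) = \<xi> (Suc j) + (cos t)^2"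
      using n \<xi>[of "Suc j"] j by (simp add: power2_eq_square algebra_simps)
    finally show ?thesis .
  qed
  then show ?thesis
    unfolding kippenhahn_poly_def entries by (rule det_tridiag_7)
qed

section \<open>Splitting the cubic into linear factors\<close>

lemma cubic_coeffs_zero:
  fixes c0 c1 c2 c3 :: real
  assumes "\<And>x. c3 * x^3 + c2 * x^2 + c1 * x + c0 = 0"
  shows "c0 = 0" "c1 = 0" "c2 = 0" "c3 = 0"
  using assms[of 0] assms[of 1] assms[of "-1"] assms[of 2] by simp_all

text \<open>Restricted to a line, the cubic is a polynomial in u, and these are its coefficients of
  u^2, u and 1. In the first, the factor of \<open>c\<close> is the derivative of a^3 - 6 a^2 + 10 a
  - 4, the coefficient of u^3; so a slope that is a simple root determines its offset.\<close>

lemma kcubic_line_coeffs: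
  assumes "\<And>u. kcubic (\<lambda>j. \<xi> j + u) (a * u + c) = 0"
  defines "l \<equiv> 4 * \<xi> 1 + 3 * \<xi> 2 + 3 * \<xi> 3 + 3 * \<xi> 4 + 3 * \<xi> 5 + 4 * \<xi> 6"
  shows "(3 * a^2 - 12 * a + 10) * c = path_e1 \<xi> * a^2 - l * a
       + (3 * \<xi> 1 + \<xi> 2 + 2 * \<xi> 3 + 2 * \<xi> 4 + \<xi> 5 + 3 * \<xi> 6)"
    and "3 * a * c^2 - 2 * path_e1 \<xi> * a * c - 6 * c^2 + path_e2 \<xi> * a + l * c
       = 2 * \<xi> 1 * \<xi> 3 + \<xi> 1 * \<xi> 4 + \<xi> 1 * \<xi> 5 + 2 * \<xi> 1 * \<xi> 6 + \<xi> 2 * \<xi> 4 + \<xi> 2 * \<xi> 6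
           + \<xi> 3 * \<xi> 5 + \<xi> 3 * \<xi> 6 + 2 * \<xi> 4 * \<xi> 6"
    and "kcubic \<xi> c = 0"
proof -
  define m where "m = 3 * \<xi> 1 + \<xi> 2 + 2 * \<xi> 3 + 2 * \<xi> 4 + \<xi> 5 + 3 * \<xi> 6"
  define n where "n = 2 * \<xi> 1 * \<xi> 3 + \<xi> 1 * \<xi> 4 + \<xi> 1 * \<xi> 5 + 2 * \<xi> 1 * \<xi> 6 + \<xi> 2 * \<xi> 4 + \<xi> 2 * \<xi> 6
           + \<xi> 3 * \<xi> 5 + \<xi> 3 * \<xi> 6 + 2 * \<xi> 4 * \<xi> 6"
  have "(a^3 - 6 * a^2 + 10 * a - 4) * u^3
      + ((3 * a^2 - 12 * a + 10) * c - path_e1 \<xi> * a^2 + l * a - m) * u^2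
      + (3 * a * c^2 - 2 * path_e1 \<xi> * a * c - 6 * c^2 + path_e2 \<xi> * a + l * c - n) * u
      + kcubic \<xi> c = 0" for u
  proof -
    have "kcubic (\<lambda>j. \<xi> j + u) (a * u + c) = (a * u + c)^3 - (path_e1 \<xi> + 6 * u) * (a * u + c)^2
        + (path_e2 \<xi> + l * u + 10 * u^2) * (a * u + c) - (path_e3 \<xi> + n * u + m * u^2 + 4 * u^3)"
      unfolding kcubic_shift l_def m_def n_def ..
    then show ?thesis
      using assms(1)[of u] by (simp add: kcubic_def power2_eq_square power3_eq_cube algebra_simps)
  qed
  note coeffs = cubic_coeffs_zero[OF this]
  show "(3 * a^2 - 12 * a + 10) * c = path_e1 \<xi> * a^2 - l * a
       + (3 * \<xi> 1 + \<xi> 2 + 2 * \<xi> 3 + 2 * \<xi> 4 + \<xi> 5 + 3 * \<xi> 6)"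
    using coeffs(3) by (simp add: m_def)
  show "3 * a * c^2 - 2 * path_e1 \<xi> * a * c - 6 * c^2 + path_e2 \<xi> * a + l * c
       = 2 * \<xi> 1 * \<xi> 3 + \<xi> 1 * \<xi> 4 + \<xi> 1 * \<xi> 5 + 2 * \<xi> 1 * \<xi> 6 + \<xi> 2 * \<xi> 4 + \<xi> 2 * \<xi> 6
           + \<xi> 3 * \<xi> 5 + \<xi> 3 * \<xi> 6 + 2 * \<xi> 4 * \<xi> 6"
    using coeffs(2) unfolding n_def by linarith
  show "kcubic \<xi> c = 0" by (rule coeffs(1))
qed

text \<open>A line with slope 2 on which \<open>kcubic\<close> vanishes must have the offset \<open>lone_offset\<close>, and lines
  with the conjugate slopes \<open>2 \<plusminus> sqrt 2\<close> must have the offsets \<open>pair_mean \<plusminus> sqrt 2 * pair_spread\<close>.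
  The splitting system says that the product of these three linear factors is \<open>kcubic\<close>.\<close>

definition lone_offset :: "(nat \<Rightarrow> real) \<Rightarrow> real" where
  "lone_offset \<xi> = (\<xi> 1 + \<xi> 2 + \<xi> 5 + \<xi> 6) / 2"

definition pair_mean :: "(nat \<Rightarrow> real) \<Rightarrow> real" where
  "pair_mean \<xi> = (\<xi> 1 + \<xi> 2 + 2 * \<xi> 3 + 2 * \<xi> 4 + \<xi> 5 + \<xi> 6) / 4"

definition pair_spread :: "(nat \<Rightarrow> real) \<Rightarrow> real" where
  "pair_spread \<xi> = (\<xi> 2 + \<xi> 3 + \<xi> 4 + \<xi> 5) / 4"

definition splitting_system :: "(nat \<Rightarrow> real) \<Rightarrow> bool" where
  "splitting_system \<xi> \<longleftrightarrow>
     (\<xi> 1 + \<xi> 2 - \<xi> 5 - \<xi> 6) * (\<xi> 2 + \<xi> 3 - \<xi> 4 - \<xi> 5) = 0 \<and>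
     2 * lone_offset \<xi> * pair_mean \<xi> + ((pair_mean \<xi>)^2 - 2 * (pair_spread \<xi>)^2) = path_e2 \<xi> \<and>
     lone_offset \<xi> * ((pair_mean \<xi>)^2 - 2 * (pair_spread \<xi>)^2) = path_e3 \<xi>"

text \<open>The two conjugate factors multiply to (z - (2u + m))^2 - 2 (u + d)^2, which is free of
  \<open>sqrt 2\<close>. The choice of \<open>p\<close>, \<open>m\<close>, \<open>d\<close> matches
  the coefficients of z^2, z u and u^2; those of z and 1 are the last two equations of the
  system.\<close>

lemma splitting_system_imp_factorization:
  assumes "splitting_system \<xi>"
  defines "p \<equiv> lone_offset \<xi>" and "m \<equiv> pair_mean \<xi>" and "d \<equiv> pair_spread \<xi>"
  shows "kcubic (\<lambda>j. \<xi> j + u) z = (z - (2 * u + p)) *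
    (z - ((2 + sqrt 2) * u + (m + sqrt 2 * d))) * (z - ((2 - sqrt 2) * u + (m - sqrt 2 * d)))"
proof -
  define P where "P = m^2 - 2 * d^2"
  define n where "n = 2 * \<xi> 1 * \<xi> 3 + \<xi> 1 * \<xi> 4 + \<xi> 1 * \<xi> 5 + 2 * \<xi> 1 * \<xi> 6 + \<xi> 2 * \<xi> 4 + \<xi> 2 * \<xi> 6
           + \<xi> 3 * \<xi> 5 + \<xi> 3 * \<xi> 6 + 2 * \<xi> 4 * \<xi> 6"
  have AB: "(\<xi> 1 + \<xi> 2 - \<xi> 5 - \<xi> 6) * (\<xi> 2 + \<xi> 3 - \<xi> 4 - \<xi> 5) = 0"
    and e2: "path_e2 \<xi> = 2 * p * m + P" and e3: "path_e3 \<xi> = p * P"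
    using assms(1) unfolding splitting_system_def P_def p_def m_def d_def by simp_all
  have e1: "path_e1 \<xi> = p + 2 * m"
    by (simp add: path_e1_def p_def m_def lone_offset_def pair_mean_def field_simps)
  have l: "4 * \<xi> 1 + 3 * \<xi> 2 + 3 * \<xi> 3 + 3 * \<xi> 4 + 3 * \<xi> 5 + 4 * \<xi> 6 = 4 * p + 8 * m - 4 * d"
    by (simp add: p_def m_def d_def lone_offset_def pair_mean_def pair_spread_def field_simps)
  have mm: "3 * \<xi> 1 + \<xi> 2 + 2 * \<xi> 3 + 2 * \<xi> 4 + \<xi> 5 + 3 * \<xi> 6 = 2 * p + 8 * m - 8 * d"
    by (simp add: p_def m_def d_def lone_offset_def pair_mean_def pair_spread_def field_simps)
  \<comment> \<open>This compares the coefficients of u. Subtracting twice the comparison for z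
    leaves only the product of two linear forms that vanishes by \<open>AB\<close>.\<close>
  have "(4 * p * m - 4 * p * d + 2 * P - n) - 2 * (2 * p * m + P - path_e2 \<xi>)
      = - ((\<xi> 1 + \<xi> 2 - \<xi> 5 - \<xi> 6) * (\<xi> 2 + \<xi> 3 - \<xi> 4 - \<xi> 5)) / 2"
    unfolding P_def p_def m_def d_def n_def lone_offset_def pair_mean_def pair_spread_def path_e2_def
    by (simp add: field_simps)
  then have n: "n = 4 * p * m - 4 * p * d + 2 * P"
    unfolding AB e2 by simp
  have "kcubic (\<lambda>j. \<xi> j + u) z = (z - (2 * u + p)) * ((z - (2 * u + m))^2 - 2 * (u + d)^2)"
    unfolding kcubic_shift n_def[symmetric] e1 e2 e3 l mm n P_def
    by (simp add: power2_eq_square power3_eq_cube algebra_simps)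
  also have "(z - (2 * u + m))^2 - 2 * (u + d)^2 = (z - (2 * u + m))^2 - (sqrt 2 * (u + d))^2"
    by (simp add: power_mult_distrib)
  also have "\<dots> = (z - ((2 + sqrt 2) * u + (m + sqrt 2 * d))) * (z - ((2 - sqrt 2) * u + (m - sqrt 2 * d)))"
    by (simp add: power2_eq_square algebra_simps)
  finally show ?thesis by (simp only: mult.assoc)
qed

lemma kcubic_lines_imp_splitting_system:
  assumes "\<And>u. kcubic (\<lambda>j. \<xi> j + u) (2 * u + p) = 0"
    and "\<And>u. kcubic (\<lambda>j. \<xi> j + u) ((2 + sqrt 2) * u + q) = 0"
    and "\<And>u. kcubic (\<lambda>j. \<xi> j + u) ((2 - sqrt 2) * u + r) = 0"
  shows "splitting_system \<xi>"
proof -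
  define m d where "m = pair_mean \<xi>" and "d = pair_spread \<xi>"
  define s where "s = sqrt 2"
  have s2: "s^2 = 2" "s \<noteq> 0" by (auto simp: s_def)
  note P = kcubic_line_coeffs[OF assms(1)]
  note Q = kcubic_line_coeffs[OF assms(2), folded s_def]
  note R = kcubic_line_coeffs[OF assms(3), folded s_def]
  have p: "p = lone_offset \<xi>"
    using P(1) by (simp add: path_e1_def lone_offset_def)
  have q: "q = m + s * d"
  proof -
    have sq: "(2 + s)^2 = 6 + 4 * s"
      using s2 by (simp add: power2_eq_square algebra_simps)
    from Q(1) show ?thesis
      unfolding sq m_def d_def path_e1_def pair_mean_def pair_spread_def by (simp add: field_simps)
  qed
  have r: "r = m - s * d"
  proof -
    have sq: "(2 - s)^2 = 6 - 4 * s"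
      using s2 by (simp add: power2_eq_square algebra_simps)
    from R(1) show ?thesis
      unfolding sq m_def d_def path_e1_def pair_mean_def pair_spread_def by (simp add: field_simps)
  qed
  have e1: "path_e1 \<xi> = p + 2 * m"
    by (simp add: path_e1_def p m_def lone_offset_def pair_mean_def field_simps)
  have l: "4 * \<xi> 1 + 3 * \<xi> 2 + 3 * \<xi> 3 + 3 * \<xi> 4 + 3 * \<xi> 5 + 4 * \<xi> 6 = 4 * p + 8 * m - 4 * d"
    by (simp add: p m_def d_def lone_offset_def pair_mean_def pair_spread_def field_simps)
  \<comment> \<open>The coefficients of u along the two conjugate lines arise from each other by
    changing the sign of \<open>s\<close>. Their difference is therefore odd in \<open>s\<close>,
    and dividing by \<open>s\<close> leaves the equation for \<open>path_e2\<close>.\<close>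
  have "(3 * (2 + s) * q^2 - 2 * path_e1 \<xi> * (2 + s) * q - 6 * q^2 + path_e2 \<xi> * (2 + s) + (4 * p + 8 * m - 4 * d) * q)
      - (3 * (2 - s) * r^2 - 2 * path_e1 \<xi> * (2 - s) * r - 6 * r^2 + path_e2 \<xi> * (2 - s) + (4 * p + 8 * m - 4 * d) * r) = 0"
    using Q(2) R(2) unfolding l by linarith
  also have "(3 * (2 + s) * q^2 - 2 * path_e1 \<xi> * (2 + s) * q - 6 * q^2 + path_e2 \<xi> * (2 + s) + (4 * p + 8 * m - 4 * d) * q)
      - (3 * (2 - s) * r^2 - 2 * path_e1 \<xi> * (2 - s) * r - 6 * r^2 + path_e2 \<xi> * (2 - s) + (4 * p + 8 * m - 4 * d) * r)
      = s * (6 * m^2 + 6 * s^2 * d^2 - 8 * (p + 2 * m) * d - 4 * (p + 2 * m) * m + 2 * path_e2 \<xi> + 2 * (4 * p + 8 * m - 4 * d) * d)"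
      (is "_ = s * ?E")
    unfolding q r e1 by (simp add: power2_eq_square algebra_simps)
  finally have e2: "2 * p * m + (m^2 - 2 * d^2) = path_e2 \<xi>"
  proof -
    assume "s * ?E = 0"
    then have "?E = 0" using s2(2) by (metis mult_eq_0_iff)
    then show ?thesis unfolding s2(1) by (simp add: power2_eq_square algebra_simps)
  qed
  have AB: "(\<xi> 1 + \<xi> 2 - \<xi> 5 - \<xi> 6) * (\<xi> 2 + \<xi> 3 - \<xi> 4 - \<xi> 5) = 0"
    using P(2) unfolding p lone_offset_def path_e1_def path_e2_def
    by (simp add: power2_eq_square field_simps)
  have "path_e3 \<xi> = p^3 - path_e1 \<xi> * p^2 + path_e2 \<xi> * p"
    using P(3) by (simp add: kcubic_def)
  then have e3: "p * (m^2 - 2 * d^2) = path_e3 \<xi>"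
    unfolding e1 e2[symmetric] by (simp add: power2_eq_square power3_eq_cube algebra_simps)
  show ?thesis
    unfolding splitting_system_def using AB e2 e3 by (simp add: p m_def d_def)
qed

section \<open>Envelopes and ellipses\<close>

text \<open>The equation Re (cis t * z) = g t and its derivative in t prescribe the real and the
  imaginary part of cis t * z; this is the solution for z.\<close>

definition envelope :: "(real \<Rightarrow> real) \<Rightarrow> complex set" where
  "envelope g = {z. \<exists>\<theta>\<in>{-pi<..pi}. \<exists>D. (g has_real_derivative D) (at \<theta>) \<and>
     z = cis (- \<theta>) * Complex (g \<theta>) (- D)}"

lemma envelope_point_iff:
  assumes f: "(f has_real_derivative D) (at \<theta>)"
  shows "z \<in> kippenhahn_line \<theta> (f \<theta>) \<and> ((\<lambda>t. Re (cis t * z) - f t) has_real_derivative 0) (at \<theta>) \<longleftrightarrow>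
    z = cis (- \<theta>) * Complex (f \<theta>) (- D)"
proof -
  have d: "((\<lambda>t. Re (cis t * z) - f t) has_real_derivative - Im (cis \<theta> * z) - D) (at \<theta>)"
    by (auto intro!: derivative_eq_intros f simp: algebra_simps)
  have deriv: "((\<lambda>t. Re (cis t * z) - f t) has_real_derivative 0) (at \<theta>) \<longleftrightarrow> Im (cis \<theta> * z) = - D"
  proof
    assume "((\<lambda>t. Re (cis t * z) - f t) has_real_derivative 0) (at \<theta>)"
    from DERIV_unique[OF d this] show "Im (cis \<theta> * z) = - D" by linarith
  next
    assume e: "Im (cis \<theta> * z) = - D"
    show "((\<lambda>t. Re (cis t * z) - f t) has_real_derivative 0) (at \<theta>)"
      using d unfolding e by simp
  qed
  have inv: "cis \<theta> * z = w \<longleftrightarrow> z = cis (- \<theta>) * w" for w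
  proof
    assume "cis \<theta> * z = w"
    then have "cis (- \<theta>) * w = cis (- \<theta>) * cis \<theta> * z" by (simp add: mult.assoc)
    then show "z = cis (- \<theta>) * w" by (simp add: cis_mult)
  next
    assume "z = cis (- \<theta>) * w"
    then have "cis \<theta> * z = cis \<theta> * cis (- \<theta>) * w" by (simp add: mult.assoc)
    then show "cis \<theta> * z = w" by (simp add: cis_mult)
  qed
  show ?thesis
    unfolding kippenhahn_line_iff deriv inv[symmetric] by (simp only: complex_eq_iff complex.sel)
qed

text \<open>If the values differed at x, continuity would keep f and g apart nearby; if only the
  derivatives differed, the difference quotient of f - g would be nonzero nearby. Either way x would
  not be an accumulation point of coincidences.\<close>

lemma frequently_eq_imp_eq_derivative:
  fixes f g :: "real \<Rightarrow> real"
  assumes f: "(f has_real_derivative D) (at x)" and g: "(g has_real_derivative E) (at x)"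
    and freq: "\<exists>\<^sub>F t in at x. f t = g t"
  shows "f x = g x \<and> D = E"
proof -
  let ?h = "\<lambda>t. f t - g t"
  have h: "(?h has_real_derivative D - E) (at x)"
    using f g by (rule DERIV_diff)
  have not_ev: "\<not> (\<forall>\<^sub>F t in at x. ?h t \<noteq> 0)"
    using freq by (simp add: frequently_def)
  have "(?h \<longlongrightarrow> ?h x) (at x)"
    using DERIV_isCont[OF h] by (simp add: isCont_def)
  then have hx: "?h x = 0"
    using tendsto_imp_eventually_ne[of ?h "?h x" "at x" 0] not_ev by blast
  have "((\<lambda>y. (?h y - ?h x) / (y - x)) \<longlongrightarrow> D - E) (at x)"
    using h by (simp add: has_field_derivative_iff)
  then have "D - E \<noteq> 0 \<Longrightarrow> \<forall>\<^sub>F y in at x. (?h y - ?h x) / (y - x) \<noteq> 0"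
    by (rule tendsto_imp_eventually_ne)
  moreover have "\<forall>\<^sub>F y in at x. ?h y \<noteq> 0" if "\<forall>\<^sub>F y in at x. (?h y - ?h x) / (y - x) \<noteq> 0"
    using that by (rule eventually_mono) (use hx in auto)
  ultimately show ?thesis
    using not_ev hx by auto
qed

text \<open>A branch need not follow a single g near \<theta>; it may switch between them infinitely
  often. As \<open>G\<close> is finite, some g still agrees with it at angles accumulating at
  \<theta>, and the envelope point depends only on the value and the derivative at \<theta>.\<close>

lemma kippenhahn_curve_eq_envelopes:
  assumes G: "finite G" and diff: "\<And>g t. g \<in> G \<Longrightarrow> g differentiable (at t)"
    and roots: "\<And>l t. kippenhahn_poly A (complex_of_real l) t = 0 \<longleftrightarrow> (\<exists>g\<in>G. l = g t)"
  shows "kippenhahn_curve A = (\<Union>g\<in>G. envelope g)"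
proof (intro equalityI subsetI)
  fix z assume "z \<in> kippenhahn_curve A"
  then obtain \<theta> f where \<theta>: "\<theta> \<in> {-pi<..pi}" and br: "kippenhahn_branch A f \<theta>"
    and z: "z \<in> kippenhahn_line \<theta> (f \<theta>)" "((\<lambda>t. Re (cis t * z) - f t) has_real_derivative 0) (at \<theta>)"
    unfolding kippenhahn_curve_def by auto
  have ev: "\<forall>\<^sub>F t in nhds \<theta>. (\<exists>g\<in>G. f t = g t) \<and> f differentiable (at t)"
    using br unfolding kippenhahn_branch_def roots .
  then obtain D where D: "(f has_real_derivative D) (at \<theta>)"
    using eventually_nhds_x_imp_x[OF ev] by (auto simp: real_differentiable_def)
  have ev': "\<forall>\<^sub>F t in at \<theta>. \<exists>g\<in>G. f t = g t"
    using ev unfolding eventually_at_filter by (rule eventually_mono) auto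
  have "\<exists>g\<in>G. \<exists>\<^sub>F t in at \<theta>. f t = g t"
  proof (rule ccontr)
    assume "\<not> ?thesis"
    then have "\<forall>g\<in>G. \<forall>\<^sub>F t in at \<theta>. f t \<noteq> g t"
      by (simp add: frequently_def)
    then have "\<forall>\<^sub>F t in at \<theta>. \<forall>g\<in>G. f t \<noteq> g t"
      using G by (simp add: eventually_ball_finite)
    with ev' have "\<forall>\<^sub>F t in at \<theta>. False"
      by eventually_elim auto
    then show False by simp
  qed
  then obtain g where g: "g \<in> G" and freq: "\<exists>\<^sub>F t in at \<theta>. f t = g t" by blast
  obtain E where E: "(g has_real_derivative E) (at \<theta>)"
    using diff[OF g] by (auto simp: real_differentiable_def)
  have "f \<theta> = g \<theta> \<and> D = E"
    using D E freq by (rule frequently_eq_imp_eq_derivative)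
  with envelope_point_iff[OF D, of z] z have "z = cis (- \<theta>) * Complex (g \<theta>) (- E)" by simp
  then have "z \<in> envelope g"
    unfolding envelope_def using \<theta> E by blast
  then show "z \<in> (\<Union>g\<in>G. envelope g)" using g by blast
next
  fix z assume "z \<in> (\<Union>g\<in>G. envelope g)"
  then obtain g \<theta> D where g: "g \<in> G" and \<theta>: "\<theta> \<in> {-pi<..pi}"
    and D: "(g has_real_derivative D) (at \<theta>)" and z: "z = cis (- \<theta>) * Complex (g \<theta>) (- D)"
    unfolding envelope_def by blast
  have "kippenhahn_branch A g \<theta>"
    unfolding kippenhahn_branch_def roots by (rule always_eventually) (use g diff in blast)
  then show "z \<in> kippenhahn_curve A"
    unfolding kippenhahn_curve_def using envelope_point_iff[OF D, of z] z \<theta> by blast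
qed

section \<open>Equations of centered ellipses\<close>

lemma ellipse_iff_quadratic:
  assumes wa: "cmod w < a"
  shows "cmod (z - w) + cmod (z + w) = 2 * a \<longleftrightarrow>
    a^2 * (cmod z)^2 - (Re z * Re w + Im z * Im w)^2 = a^2 * (a^2 - (cmod w)^2)"
proof -
  define n m i where "n = (cmod z)^2" and "m = (cmod w)^2" and "i = Re z * Re w + Im z * Im w"
  have a: "a > 0" using wa norm_ge_zero[of w] by linarith
  have d1: "(cmod (z - w))^2 = n + m - 2 * i" and d2: "(cmod (z + w))^2 = n + m + 2 * i"
    unfolding n_def m_def i_def cmod_power2 by (simp_all add: power2_eq_square algebra_simps)
  have ma: "m < a^2"
    unfolding m_def using wa by (simp add: power_strict_mono)
  have "n * m - i^2 = (Re z * Im w - Im z * Re w)^2"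
    unfolding n_def m_def i_def cmod_power2 by (simp add: power2_eq_square algebra_simps)
  then have cs: "i^2 \<le> n * m" by (metis diff_ge_0_iff_ge zero_le_power2)
  show ?thesis
    unfolding n_def[symmetric] m_def[symmetric] i_def[symmetric]
  proof
    assume "cmod (z - w) + cmod (z + w) = 2 * a"
    then have d2': "cmod (z + w) = 2 * a - cmod (z - w)" by simp
    have "4 * (a * cmod (z - w)) = 4 * (a^2 - i)"
      using d1 d2 unfolding d2' by (simp add: power2_eq_square algebra_simps)
    then have "a * cmod (z - w) = a^2 - i" by (subst (asm) mult_cancel_left) simp
    then have "(a * cmod (z - w))^2 = (a^2 - i)^2" by (rule arg_cong)
    then have "a^2 * (n + m - 2 * i) = (a^2 - i)^2"
      by (simp add: power_mult_distrib d1)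
    then show "a^2 * n - i^2 = a^2 * (a^2 - m)"
      by (simp add: power2_eq_square algebra_simps)
  next
    assume eq: "a^2 * n - i^2 = a^2 * (a^2 - m)"
    \<comment> \<open>Squaring can be undone only if |i| <= a^2, so that a^2 - i and a^2 + i are
      nonnegative. The bound comes from the Cauchy-Schwarz inequality \<open>cs\<close>, with n
      eliminated by means of \<open>eq\<close>.\<close>
    have "a^2 * i^2 \<le> a^2 * (n * m)"
      using cs by (rule mult_left_mono) simp
    also have "\<dots> = a^2 * n * m" by simp
    also have "a^2 * n = i^2 + a^2 * (a^2 - m)"
      using eq by simp
    finally have "(a^2 - m) * i^2 \<le> (a^2 - m) * (a^2 * m)"
      by (simp add: algebra_simps)
    then have "i^2 \<le> a^2 * m"
      using ma by simp
    also have "\<dots> \<le> a^2 * a^2"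
      using ma by (intro mult_left_mono) auto
    finally have "i^2 \<le> (a^2)^2" by (simp add: power2_eq_square)
    then have i: "\<bar>i\<bar> \<le> a^2"
      by (metis abs_le_square_iff abs_of_nonneg zero_le_power2)
    have "(a * cmod (z - w))^2 = (a^2 - i)^2"
      using eq by (simp add: power_mult_distrib d1) (simp add: power2_eq_square algebra_simps)
    then have e1: "a * cmod (z - w) = a^2 - i"
      using a i by (simp add: power2_eq_iff_nonneg)
    have "(a * cmod (z + w))^2 = (a^2 + i)^2"
      using eq by (simp add: power_mult_distrib d2) (simp add: power2_eq_square algebra_simps)
    then have e2: "a * cmod (z + w) = a^2 + i"
      using a i by (simp add: power2_eq_iff_nonneg)
    have "a * (cmod (z - w) + cmod (z + w)) = a * (2 * a)"
      using e1 e2 by (simp add: distrib_left power2_eq_square)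
    then show "cmod (z - w) + cmod (z + w) = 2 * a"
      using a by simp
  qed
qed

text \<open>The ellipse with foci \<plusminus> sqrt \<alpha> and squared semi-axes \<alpha> +
  \<beta> and \<beta>. For \<beta> = 0 and \<alpha> > 0 the quadratic equation would describe the
  whole real axis, so the pair of foci is listed separately.\<close>

definition axis_ellipse :: "real \<Rightarrow> real \<Rightarrow> complex set" where
  "axis_ellipse \<alpha> \<beta> = {z. if \<beta> = 0 then z = sqrt \<alpha> \<or> z = - sqrt \<alpha>
     else \<beta> * (Re z)^2 + (\<alpha> + \<beta>) * (Im z)^2 = (\<alpha> + \<beta>) * \<beta>}"

lemma centered_ellipse_axis_ellipse:
  assumes "\<alpha> > 0" "\<beta> \<ge> 0"
  shows "centered_ellipse (axis_ellipse \<alpha> \<beta>)"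
proof (cases "\<beta> = 0")
  case True
  then have "axis_ellipse \<alpha> \<beta> = {complex_of_real (sqrt \<alpha>), - complex_of_real (sqrt \<alpha>)}"
    unfolding axis_ellipse_def by auto
  moreover have "complex_of_real (sqrt \<alpha>) \<noteq> 0"
    using assms by simp
  ultimately show ?thesis
    unfolding centered_ellipse_def by blast
next
  case False
  define a where "a = sqrt (\<alpha> + \<beta>)"
  define f where "f = complex_of_real (sqrt \<alpha>)"
  have a2: "a^2 = \<alpha> + \<beta>" and f2: "(cmod f)^2 = \<alpha>" "Re f = sqrt \<alpha>" "Im f = 0"
    using assms by (simp_all add: a_def f_def)
  have fa: "cmod f < a"
    using assms False by (simp add: a_def f_def)
  have "z \<in> axis_ellipse \<alpha> \<beta> \<longleftrightarrow> cmod (z - f) + cmod (z + f) = 2 * a" for z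
  proof -
    have "a^2 * (cmod z)^2 - (Re z * Re f + Im z * Im f)^2
        = \<beta> * (Re z)^2 + (\<alpha> + \<beta>) * (Im z)^2"
      using assms by (simp add: a2 f2 cmod_power2 power_mult_distrib algebra_simps)
    then show ?thesis
      unfolding ellipse_iff_quadratic[OF fa] a2 f2 axis_ellipse_def using False by simp
  qed
  then have "axis_ellipse \<alpha> \<beta> = {z. cmod (z - f) + cmod (z + f) = 2 * a}" by auto
  then show ?thesis
    unfolding centered_ellipse_def using fa by blast
qed

lemma axis_ellipse_inj:
  assumes pos: "\<alpha> > 0" "\<alpha>' > 0" "\<beta> \<ge> 0" "\<beta>' \<ge> 0" and eq: "axis_ellipse \<alpha> \<beta> = axis_ellipse \<alpha>' \<beta>'"
  shows "\<alpha> = \<alpha>'"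
proof -
  have "complex_of_real (sqrt (\<alpha> + \<beta>)) \<in> axis_ellipse \<alpha> \<beta>"
    using pos by (simp add: axis_ellipse_def algebra_simps)
  then have "complex_of_real (sqrt (\<alpha> + \<beta>)) \<in> axis_ellipse \<alpha>' \<beta>'"
    by (simp only: eq)
  then have "(sqrt (\<alpha> + \<beta>))^2 = \<alpha>' + \<beta>'"
  proof (cases "\<beta>' = 0")
    case True
    then have "sqrt (\<alpha> + \<beta>) = sqrt \<alpha>' \<or> sqrt (\<alpha> + \<beta>) = - sqrt \<alpha>'"
      using \<open>_ \<in> axis_ellipse \<alpha>' \<beta>'\<close> by (simp add: axis_ellipse_def flip: of_real_minus)
    then have "(sqrt (\<alpha> + \<beta>))^2 = (sqrt \<alpha>')^2" by (metis power2_minus)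
    then show ?thesis using pos True by simp
  next
    case False
    then show ?thesis
      using \<open>_ \<in> axis_ellipse \<alpha>' \<beta>'\<close> by (simp add: axis_ellipse_def)
  qed
  then have sum: "\<alpha> + \<beta> = \<alpha>' + \<beta>'"
    using pos by simp
  \<comment> \<open>Only a nondegenerate ellipse has the point i sqrt \<delta>. The claim is stated
    for arbitrary parameters so that whichever of the two ellipses is nondegenerate can supply
    it.\<close>
  have covertex: "\<delta> = \<delta>'"
    if "\<delta> > 0" "\<delta>' \<ge> 0" "\<gamma>' > 0" and same: "axis_ellipse \<gamma> \<delta> = axis_ellipse \<gamma>' \<delta>'" for \<gamma> \<gamma>' \<delta> \<delta>'
  proof -
    have "\<i> * sqrt \<delta> \<in> axis_ellipse \<gamma> \<delta>"
      using that(1) by (simp add: axis_ellipse_def)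
    then have "\<i> * sqrt \<delta> \<in> axis_ellipse \<gamma>' \<delta>'"
      by (simp only: same)
    then show ?thesis
      using that(1-3) by (auto simp: axis_ellipse_def complex_eq_iff split: if_splits)
  qed
  have "\<beta> = \<beta>'"
  proof (cases "\<beta> > 0")
    case True
    then show ?thesis using covertex[of \<beta> \<beta>' \<alpha>' \<alpha>] pos eq by blast
  next
    case False
    then show ?thesis using covertex[of \<beta>' \<beta> \<alpha> \<alpha>'] pos eq by force
  qed
  then show ?thesis using sum by simp
qed

section \<open>Families of lines that envelop an axis ellipse\<close>

text \<open>For \<open>\<beta> = 0\<close> the square root would be \<open>sqrt \<alpha> * \<bar>cos t\<bar>\<close>, which is not differentiable
  where the cosine vanishes.\<close>

definition ellipse_branch :: "real \<Rightarrow> real \<Rightarrow> real \<Rightarrow> real" where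
  "ellipse_branch \<alpha> \<beta> t = (if \<beta> = 0 then sqrt \<alpha> * cos t else sqrt (\<alpha> * (cos t)^2 + \<beta>))"

lemma ellipse_branch_square:
  assumes "\<alpha> > 0" "\<beta> \<ge> 0"
  shows "(ellipse_branch \<alpha> \<beta> t)^2 = \<alpha> * (cos t)^2 + \<beta>"
  using assms by (simp add: ellipse_branch_def power_mult_distrib)

lemma ellipse_branch_deriv:
  assumes "\<alpha> > 0" "\<beta> > 0"
  shows "(ellipse_branch \<alpha> \<beta> has_real_derivative - \<alpha> * cos t * sin t / ellipse_branch \<alpha> \<beta> t) (at t)"
proof -
  have *: "\<alpha> * (cos t)^2 + \<beta> > 0"
    using assms by (simp add: add_nonneg_pos)
  have "ellipse_branch \<alpha> \<beta> = (\<lambda>t. sqrt (\<alpha> * (cos t)^2 + \<beta>))"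
    using assms by (auto simp: ellipse_branch_def)
  then show ?thesis
    using * by (auto intro!: derivative_eq_intros simp: field_simps)
qed

text \<open>As k cos t = Re (cis t * k), all lines of the family pass through k.\<close>

lemma envelope_cos: "envelope (\<lambda>t. k * cos t) = {complex_of_real k}"
proof -
  have d: "((\<lambda>t. k * cos t) has_real_derivative - k * sin t) (at t)" for t
    by (auto intro!: derivative_eq_intros)
  have pt: "cis (- t) * Complex (k * cos t) (- (- k * sin t)) = complex_of_real k" for t
  proof -
    have "Complex (k * cos t) (- (- k * sin t)) = cis t * complex_of_real k"
      by (simp add: complex_eq_iff)
    then show ?thesis by (simp add: mult.assoc[symmetric] cis_mult)
  qed
  have "z = complex_of_real k" if "z \<in> envelope (\<lambda>t. k * cos t)" for z
  proof -
    obtain t D where D: "((\<lambda>t. k * cos t) has_real_derivative D) (at t)"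
      and z: "z = cis (- t) * Complex (k * cos t) (- D)"
      using \<open>z \<in> _\<close> unfolding envelope_def by blast
    show ?thesis using z unfolding DERIV_unique[OF D d] pt .
  qed
  moreover have "0 \<in> {- pi<..pi}" by simp
  then have "complex_of_real k \<in> envelope (\<lambda>t. k * cos t)"
    unfolding envelope_def
    by (intro CollectI bexI[of _ 0] exI[of _ "- k * sin 0"] conjI d pt[of 0, symmetric])
  ultimately show ?thesis by blast
qed

lemma envelope_ellipse_branch:
  assumes "\<alpha> > 0" "\<beta> > 0" and \<sigma>: "\<sigma>^2 = 1"
  shows "envelope (\<lambda>t. \<sigma> * ellipse_branch \<alpha> \<beta> t) = axis_ellipse \<alpha> \<beta>"
proof -
  let ?g = "\<lambda>t. \<sigma> * ellipse_branch \<alpha> \<beta> t"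
  define r where "r = ellipse_branch \<alpha> \<beta>"
  define D where "D t = \<sigma> * (- \<alpha> * cos t * sin t / r t)" for t
  have d: "(?g has_real_derivative D t) (at t)" for t
    unfolding D_def r_def by (rule DERIV_cmult[OF ellipse_branch_deriv[OF assms(1,2)]])
  have r2: "(r t)^2 = \<alpha> * (cos t)^2 + \<beta>" for t
    unfolding r_def using assms by (simp add: ellipse_branch_square)
  have r0: "r t > 0" for t
  proof -
    have "\<alpha> * (cos t)^2 + \<beta> > 0" using assms by (simp add: add_nonneg_pos)
    then show ?thesis unfolding r_def ellipse_branch_def using assms by simp
  qed
  have pt: "cis (- t) * Complex (?g t) (- D t) =
      Complex (\<sigma> * cos t * (\<alpha> + \<beta>) / r t) (- \<sigma> * \<beta> * sin t / r t)" for t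
  proof -
    have s: "(sin t)^2 = 1 - (cos t)^2" by (simp add: sin_squared_eq)
    have divI: "u = v / r t" if "r t * u = v" for u v
      using that r0[of t] by auto
    have "r t * (cos t * r t + sin t * (\<alpha> * cos t * sin t / r t)) = cos t * ((r t)^2 + \<alpha> * (sin t)^2)"
      using r0[of t] by (simp add: power2_eq_square field_simps)
    also have "\<dots> = cos t * (\<alpha> + \<beta>)"
      unfolding r2 s by (simp add: algebra_simps)
    finally have x: "cos t * r t + sin t * (\<alpha> * cos t * sin t / r t) = cos t * (\<alpha> + \<beta>) / r t"
      by (rule divI)
    have "r t * (- sin t * r t + cos t * (\<alpha> * cos t * sin t / r t)) = sin t * (\<alpha> * (cos t)^2 - (r t)^2)"
      using r0[of t] by (simp add: power2_eq_square field_simps)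
    also have "\<dots> = - \<beta> * sin t"
      unfolding r2 by simp
    finally have y: "- sin t * r t + cos t * (\<alpha> * cos t * sin t / r t) = - \<beta> * sin t / r t"
      by (rule divI)
    have "Re (cis (- t) * Complex (?g t) (- D t)) = \<sigma> * (cos t * r t + sin t * (\<alpha> * cos t * sin t / r t))"
      by (simp add: D_def r_def algebra_simps)
    moreover have "Im (cis (- t) * Complex (?g t) (- D t)) = \<sigma> * (- sin t * r t + cos t * (\<alpha> * cos t * sin t / r t))"
      by (simp add: D_def r_def algebra_simps)
    ultimately show ?thesis
      unfolding x y by (simp add: complex_eq_iff)
  qed
  have env: "envelope ?g = {z. \<exists>t\<in>{-pi<..pi}. z = Complex (\<sigma> * cos t * (\<alpha> + \<beta>) / r t) (- \<sigma> * \<beta> * sin t / r t)}"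
  proof (intro equalityI subsetI)
    fix z assume "z \<in> envelope ?g"
    then obtain t E where t: "t \<in> {-pi<..pi}" and E: "(?g has_real_derivative E) (at t)"
      and z: "z = cis (- t) * Complex (?g t) (- E)"
      unfolding envelope_def by blast
    from z have "z = Complex (\<sigma> * cos t * (\<alpha> + \<beta>) / r t) (- \<sigma> * \<beta> * sin t / r t)"
      unfolding DERIV_unique[OF E d] pt .
    with t show "z \<in> {z. \<exists>t\<in>{-pi<..pi}. z = Complex (\<sigma> * cos t * (\<alpha> + \<beta>) / r t) (- \<sigma> * \<beta> * sin t / r t)}"
      by blast
  next
    fix z assume "z \<in> {z. \<exists>t\<in>{-pi<..pi}. z = Complex (\<sigma> * cos t * (\<alpha> + \<beta>) / r t) (- \<sigma> * \<beta> * sin t / r t)}"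
    then obtain t where t: "t \<in> {-pi<..pi}"
      and z: "z = Complex (\<sigma> * cos t * (\<alpha> + \<beta>) / r t) (- \<sigma> * \<beta> * sin t / r t)" by blast
    have "z = cis (- t) * Complex (?g t) (- D t)"
      unfolding pt by (rule z)
    with t d show "z \<in> envelope ?g" unfolding envelope_def by blast
  qed
  have mem: "z \<in> axis_ellipse \<alpha> \<beta> \<longleftrightarrow> \<beta> * (Re z)^2 + (\<alpha> + \<beta>) * (Im z)^2 = (\<alpha> + \<beta>) * \<beta>" for z
    using assms by (simp add: axis_ellipse_def)
  show ?thesis
  proof (intro equalityI subsetI)
    fix z assume "z \<in> envelope ?g"
    then obtain t where z: "z = Complex (\<sigma> * cos t * (\<alpha> + \<beta>) / r t) (- \<sigma> * \<beta> * sin t / r t)"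
      unfolding env by blast
    have "\<beta> * (Re z)^2 + (\<alpha> + \<beta>) * (Im z)^2
        = (\<alpha> + \<beta>) * \<beta> * (((\<alpha> + \<beta>) * (cos t)^2 + \<beta> * (sin t)^2) / (r t)^2)"
      unfolding z using r0[of t]
      by (simp add: power_mult_distrib power_divide \<sigma>) (simp add: power2_eq_square field_simps)
    also have "(\<alpha> + \<beta>) * (cos t)^2 + \<beta> * (sin t)^2 = (r t)^2"
      unfolding r2 sin_squared_eq by (simp add: algebra_simps)
    finally show "z \<in> axis_ellipse \<alpha> \<beta>"
      unfolding mem using r0[of t] by simp
  next
    fix z assume "z \<in> axis_ellipse \<alpha> \<beta>"
    then have z: "\<beta> * (Re z)^2 + (\<alpha> + \<beta>) * (Im z)^2 = (\<alpha> + \<beta>) * \<beta>"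
      unfolding mem .
    \<comment> \<open>This inverts the parametrization in \<open>env\<close>: at the point belonging
      to t, \<open>w\<close> is cis t / r t. So the angle must be \<open>Arg w\<close>, and it
      remains to check that the modulus is 1 / r t.\<close>
    define w where "w = Complex (\<sigma> * Re z / (\<alpha> + \<beta>)) (- \<sigma> * Im z / \<beta>)"
    define t where "t = Arg w"
    define \<rho> where "\<rho> = cmod w"
    have t: "t \<in> {-pi<..pi}"
      using Arg_bounded[of w] by (auto simp: t_def)
    have w: "w = rcis \<rho> t"
      unfolding t_def \<rho>_def by (simp add: rcis_cmod_Arg)
    have "Re w = \<rho> * cos t" "Im w = \<rho> * sin t"
      unfolding w by simp_all
    then have x: "\<sigma> * Re z = (\<alpha> + \<beta>) * (\<rho> * cos t)" and y: "\<sigma> * Im z = - \<beta> * (\<rho> * sin t)"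
      using assms by (simp_all add: w_def field_simps)
    have \<sigma>\<sigma>: "\<sigma> * (\<sigma> * v) = v" for v
      using \<sigma> by (simp add: mult.assoc[symmetric] power2_eq_square)
    have x': "Re z = \<sigma> * ((\<alpha> + \<beta>) * (\<rho> * cos t))" and y': "Im z = - \<sigma> * (\<beta> * (\<rho> * sin t))"
      using \<sigma>\<sigma>[of "Re z"] \<sigma>\<sigma>[of "Im z"] unfolding x y by simp_all
    have "(\<alpha> + \<beta>) * \<beta> * (\<rho>^2 * (r t)^2) = \<beta> * (\<sigma> * Re z)^2 + (\<alpha> + \<beta>) * (\<sigma> * Im z)^2"
      unfolding x y r2
      by (simp add: power_mult_distrib sin_squared_eq) (simp add: power2_eq_square algebra_simps)
    also have "\<dots> = (\<alpha> + \<beta>) * \<beta> * 1"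
      using z \<sigma> by (simp add: power_mult_distrib)
    finally have "(\<rho> * r t)^2 = 1^2"
      using assms by (simp add: power_mult_distrib)
    then have "\<rho> * r t = 1"
      using r0[of t] by (subst (asm) power2_eq_iff_nonneg) (auto simp: \<rho>_def)
    then have "\<rho> = 1 / r t"
      using r0[of t] by (simp add: field_simps)
    then have "z = Complex (\<sigma> * cos t * (\<alpha> + \<beta>) / r t) (- \<sigma> * \<beta> * sin t / r t)"
      by (simp add: complex_eq_iff x' y')
    then show "z \<in> envelope ?g"
      unfolding env using t by blast
  qed
qed

text \<open>For \<beta> > 0 either sign already yields the whole ellipse; for \<beta> = 0 each sign
  yields one focus.\<close>

lemma envelope_ellipse_branches:
  assumes "\<alpha> > 0" "\<beta> \<ge> 0"
  shows "envelope (\<lambda>t. ellipse_branch \<alpha> \<beta> t) \<union> envelope (\<lambda>t. - ellipse_branch \<alpha> \<beta> t) = axis_ellipse \<alpha> \<beta>"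
proof (cases "\<beta> = 0")
  case True
  then show ?thesis
    using envelope_cos[of "sqrt \<alpha>"] envelope_cos[of "- sqrt \<alpha>"]
    by (auto simp: ellipse_branch_def axis_ellipse_def)
next
  case False
  then show ?thesis
    using envelope_ellipse_branch[of \<alpha> \<beta> 1] envelope_ellipse_branch[of \<alpha> \<beta> "- 1"] assms by simp
qed

lemma ellipse_branch_differentiable:
  assumes "\<alpha> > 0" "\<beta> \<ge> 0"
  shows "ellipse_branch \<alpha> \<beta> differentiable (at t)"
proof (cases "\<beta> = 0")
  case True
  then have "ellipse_branch \<alpha> \<beta> = (\<lambda>t. sqrt \<alpha> * cos t)"
    by (simp add: ellipse_branch_def fun_eq_iff)
  moreover have "((\<lambda>t. sqrt \<alpha> * cos t) has_real_derivative sqrt \<alpha> * - sin t) (at t)"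
    by (auto intro!: derivative_eq_intros)
  ultimately show ?thesis
    unfolding real_differentiable_def by metis
next
  case False
  then show ?thesis
    using ellipse_branch_deriv[of \<alpha> \<beta> t] assms unfolding real_differentiable_def by auto
qed

lemma three_ellipses_if_roots:
  assumes pos: "\<And>i. i < 3 \<Longrightarrow> \<alpha> i > 0" "\<And>i. i < 3 \<Longrightarrow> \<beta> i \<ge> 0"
    and inj: "inj_on \<alpha> {..<3::nat}"
    and roots: "\<And>l t. kippenhahn_poly A (complex_of_real l) t = 0 \<longleftrightarrow>
        l = 0 \<or> (\<exists>i<3. l^2 = \<alpha> i * (cos t)^2 + \<beta> i)"
  shows "three_ellipses_and_origin (kippenhahn_curve A)"
proof -
  define b where "b i = ellipse_branch (\<alpha> i) (\<beta> i)" for i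
  define G where "G = {\<lambda>t. 0} \<union> (b ` {..<3} \<union> (\<lambda>i t. - b i t) ` {..<3})"
  have "kippenhahn_poly A (complex_of_real l) t = 0 \<longleftrightarrow> (\<exists>g\<in>G. l = g t)" for l t
  proof -
    have sq: "l^2 = \<alpha> i * (cos t)^2 + \<beta> i \<longleftrightarrow> l = b i t \<or> l = - b i t" if "i < 3" for i
      using pos that by (simp add: b_def ellipse_branch_square[symmetric] power2_eq_iff)
    then have "(\<exists>i<3. l^2 = \<alpha> i * (cos t)^2 + \<beta> i) \<longleftrightarrow> (\<exists>i<3. l = b i t \<or> l = - b i t)"
      by blast
    then show ?thesis unfolding roots by (auto simp: G_def)
  qed
  moreover have "g differentiable (at t)" if "g \<in> G" for g t
    using that pos by (auto simp: G_def b_def intro!: ellipse_branch_differentiable differentiable_minus)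
  moreover have "finite G" by (simp add: G_def)
  ultimately have "kippenhahn_curve A = (\<Union>g\<in>G. envelope g)"
    by (intro kippenhahn_curve_eq_envelopes)
  also have "\<dots> = envelope (\<lambda>t. 0) \<union> (\<Union>i<3. envelope (b i) \<union> envelope (\<lambda>t. - b i t))"
    unfolding G_def by blast
  also have "(\<Union>i<3. envelope (b i) \<union> envelope (\<lambda>t. - b i t)) = (\<Union>i<3. axis_ellipse (\<alpha> i) (\<beta> i))"
    unfolding b_def by (intro SUP_cong refl envelope_ellipse_branches) (auto simp: pos)
  also have "envelope (\<lambda>t. 0) = {0}"
    using envelope_cos[of 0] by simp
  also have "(\<Union>i<3. axis_ellipse (\<alpha> i) (\<beta> i)) =
      axis_ellipse (\<alpha> 0) (\<beta> 0) \<union> axis_ellipse (\<alpha> 1) (\<beta> 1) \<union> axis_ellipse (\<alpha> 2) (\<beta> 2)"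
    by (auto simp: numeral_3_eq_3 less_Suc_eq numeral_2_eq_2)
  finally have "kippenhahn_curve A = axis_ellipse (\<alpha> 0) (\<beta> 0) \<union> axis_ellipse (\<alpha> 1) (\<beta> 1)
      \<union> axis_ellipse (\<alpha> 2) (\<beta> 2) \<union> {0}" by blast
  moreover have "axis_ellipse (\<alpha> i) (\<beta> i) \<noteq> axis_ellipse (\<alpha> j) (\<beta> j)" if "i < 3" "j < 3" "i \<noteq> j" for i j
    using axis_ellipse_inj[of "\<alpha> i" "\<alpha> j" "\<beta> i" "\<beta> j"] pos inj that by (auto dest: inj_onD)
  ultimately show ?thesis
    unfolding three_ellipses_and_origin_def
    by (intro exI[of _ "axis_ellipse (\<alpha> 0) (\<beta> 0)"] exI[of _ "axis_ellipse (\<alpha> 1) (\<beta> 1)"]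
        exI[of _ "axis_ellipse (\<alpha> 2) (\<beta> 2)"]) (simp add: centered_ellipse_axis_ellipse pos)
qed

section \<open>Families of lines whose envelope runs inside three ellipses\<close>

lemma open_real_contains_Ioo:
  fixes V :: "real set"
  assumes "open V" "x \<in> V"
  obtains e where "e > 0" "{x - e<..<x + e} \<subseteq> V"
proof -
  obtain e where "e > 0" "\<And>y. \<bar>y - x\<bar> < e \<Longrightarrow> y \<in> V"
    using assms unfolding open_dist dist_real_def by blast
  then show ?thesis
    by (intro that[of e]) (auto simp: abs_if)
qed

lemma open_real_infinite:
  fixes V :: "real set"
  assumes "open V" "V \<noteq> {}"
  shows "infinite V"
proof -
  obtain x where "x \<in> V" using assms by blast
  then obtain e where "e > 0" "{x - e<..<x + e} \<subseteq> V"
    using open_real_contains_Ioo[OF assms(1)] by blast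
  then show ?thesis
    using infinite_super[of "{x - e<..<x + e}" V] by simp
qed

text \<open>Either the first set contains the whole image, or the angles whose image avoids it form
  a nonempty open set covered by the remaining sets.\<close>

lemma finite_closed_cover_open_subset:
  assumes "finite F" and "\<And>S. S \<in> F \<Longrightarrow> closed S"
    and "open U" "U \<noteq> {}" "continuous_on U z" "z ` U \<subseteq> \<Union>F"
  obtains S V where "S \<in> F" "open V" "V \<noteq> {}" "V \<subseteq> U" "z ` V \<subseteq> S"
proof -
  have "\<exists>S\<in>F. \<exists>V. open V \<and> V \<noteq> {} \<and> V \<subseteq> U \<and> z ` V \<subseteq> S"
    using assms
  proof (induction F arbitrary: U rule: finite_induct)
    case empty
    then show ?case by blast
  next
    case (insert S F)
    show ?case
    proof (cases "z ` U \<subseteq> S")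
      case True
      then show ?thesis using insert.prems by blast
    next
      case False
      define U' where "U' = z -` (- S) \<inter> U"
      have "open U'"
        unfolding U'_def using insert.prems continuous_on_open_vimage[of U z] by blast
      moreover have "U' \<noteq> {}" "U' \<subseteq> U" "z ` U' \<subseteq> \<Union>F"
        using False insert.prems(5) unfolding U'_def by auto
      moreover have "continuous_on U' z"
        using insert.prems(4) \<open>U' \<subseteq> U\<close> by (rule continuous_on_subset)
      ultimately obtain T V where "T \<in> F" "open V" "V \<noteq> {}" "V \<subseteq> U'" "z ` V \<subseteq> T"
        using insert.IH[of U'] insert.prems(1) by auto
      then show ?thesis using \<open>U' \<subseteq> U\<close> by blast
    qed
  qed
  then show ?thesis using that by blast
qed

text \<open>In the frame turned by the angle \<open>- t\<close>, \<open>(u, v)\<close> is a point of the ellipse with foci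
  \<open>\<plusminus> (p, q)\<close> and squared semi-axis \<open>e\<close> at which the tangent is parallel to the second axis.\<close>

lemma tangency_height:
  fixes e u v p q :: real
  assumes on: "e * (u^2 + v^2) - (u * p + v * q)^2 = e * (e - p^2 - q^2)"
    and tangent: "e * v = (u * p + v * q) * q" and lt: "p^2 + q^2 < e"
  shows "u^2 = e - q^2"
proof -
  \<comment> \<open>An elimination of v: the right side is a combination of the differences of the
    two sides of \<open>on\<close> and \<open>tangent\<close>.\<close>
  have "e * (e - p^2 - q^2) * (u^2 - (e - q^2))
      = (e - q^2) * ((e * (u^2 + v^2) - (u * p + v * q)^2 - e * (e - p^2 - q^2)) - v * (e * v - (u * p + v * q) * q))
        + p * q * u * (e * v - (u * p + v * q) * q)"
    by (simp add: power2_eq_square algebra_simps)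
  also have "\<dots> = 0" using on tangent by simp
  finally have "e * (e - p^2 - q^2) * (u^2 - (e - q^2)) = 0" .
  moreover have "e > 0" using lt sum_power2_ge_zero[of p q] by linarith
  ultimately show ?thesis using lt by simp
qed

text \<open>Squares are used because the lines may alternate between a point and its antipode, and
  the square is the same for both.\<close>

lemma support_square_of_const_point:
  assumes "\<And>t. t \<in> V \<Longrightarrow> (f t)^2 = (cos t * x - sin t * y)^2"
  shows "\<exists>\<alpha> \<beta> \<gamma>. \<forall>t\<in>V. (f t)^2 = \<alpha> * (cos t)^2 + \<beta> * (cos t * sin t) + (\<gamma>::real)"
proof -
  have "(cos t * x - sin t * y)^2 = (x^2 - y^2) * (cos t)^2 + (- 2 * x * y) * (cos t * sin t) + y^2" for t
  proof -
    have "(cos t * x - sin t * y)^2 = x^2 * (cos t)^2 - 2 * x * y * (cos t * sin t) + y^2 * (sin t)^2"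
      by (simp add: power2_eq_square algebra_simps)
    then show ?thesis unfolding sin_squared_eq by (simp add: algebra_simps)
  qed
  with assms show ?thesis by metis
qed

text \<open>The envelope point moves with velocity \<open>f + f''\<close> in the direction of its line. So at every
  angle it is stationary, or its line is tangent to the ellipse and \<open>f\<close> is up to sign the
  support function of the ellipse (the two kinds of solutions of Clairaut's equation).\<close>

lemma support_square_on_ellipse:
  fixes f f' f'' :: "real \<Rightarrow> real"
  assumes U: "open U" "U \<noteq> {}" and w: "cmod w < a"
    and f: "\<And>t. t \<in> U \<Longrightarrow> (f has_real_derivative f' t) (at t)"
    and f': "\<And>t. t \<in> U \<Longrightarrow> (f' has_real_derivative f'' t) (at t)"
    and on: "\<And>t. t \<in> U \<Longrightarrow> cmod (cis (- t) * Complex (f t) (- f' t) - w)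
        + cmod (cis (- t) * Complex (f t) (- f' t) + w) = 2 * a"
  shows "\<exists>V \<alpha> \<beta> \<gamma>. open V \<and> V \<noteq> {} \<and> V \<subseteq> U \<and>
    (\<forall>t\<in>V. (f t)^2 = \<alpha> * (cos t)^2 + \<beta> * (cos t * sin t) + \<gamma>)"
proof -
  define x where "x t = cos t * f t - sin t * f' t" for t
  define y where "y t = - sin t * f t - cos t * f' t" for t
  define p q where "p = Re w" and "q = Im w"
  define k where "k t = f t + f'' t" for t
  define N where "N t = a^2 * ((x t)^2 + (y t)^2) - (x t * p + y t * q)^2" for t
  have a: "a > 0" using w norm_ge_zero[of w] by linarith
  have pq: "p^2 + q^2 < a^2"
    using w a unfolding p_def q_def cmod_power2[symmetric] by (simp add: power_strict_mono)
  have z: "cis (- t) * Complex (f t) (- f' t) = Complex (x t) (y t)" for t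
    by (simp add: x_def y_def complex_eq_iff)
  have x': "(x has_real_derivative - sin t * k t) (at t)" if "t \<in> U" for t
    unfolding x_def k_def
    by (auto intro!: derivative_eq_intros f[OF that] f'[OF that] simp: algebra_simps)
  have y': "(y has_real_derivative - cos t * k t) (at t)" if "t \<in> U" for t
    unfolding y_def k_def
    by (auto intro!: derivative_eq_intros f[OF that] f'[OF that] simp: algebra_simps)
  have N: "N t = a^2 * (a^2 - p^2 - q^2)" if "t \<in> U" for t
    using ellipse_iff_quadratic[OF w, of "Complex (x t) (y t)"] on[OF that]
    unfolding z N_def p_def q_def by (simp add: cmod_power2 diff_diff_eq)
  \<comment> \<open>Up to the factor -2, the left side is the derivative of \<open>N\<close>, which
    is constant on \<open>U\<close>.\<close>
  have tangent: "k t * (a^2 * (x t * sin t + y t * cos t) - (x t * p + y t * q) * (sin t * p + cos t * q)) = 0"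
    if t: "t \<in> U" for t
  proof -
    have d: "(N has_real_derivative - 2 * (k t * (a^2 * (x t * sin t + y t * cos t)
        - (x t * p + y t * q) * (sin t * p + cos t * q)))) (at t)"
      unfolding N_def
      by (auto intro!: derivative_eq_intros x'[OF t] y'[OF t] simp: power2_eq_square algebra_simps)
    obtain e where e: "e > 0" "{t - e<..<t + e} \<subseteq> U"
      using open_real_contains_Ioo[OF U(1) t] .
    have "N t = N s" if "\<bar>t - s\<bar> < e" for s
    proof -
      have "s \<in> U" using e that by (auto simp: abs_if split: if_splits)
      then show ?thesis using t N by simp
    qed
    then show ?thesis
      using DERIV_local_const[OF d e(1)] by simp
  qed
  \<comment> \<open>P + iQ = cis t * w is the focus in the frame in which the line is vertical; the
    envelope point has the coordinates f and -f' there.\<close>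
  define P Q where "P t = cos t * p - sin t * q" and "Q t = sin t * p + cos t * q" for t
  have height: "(f t)^2 = a^2 - (Q t)^2" if t: "t \<in> U" and k: "k t \<noteq> 0" for t
  proof (rule tangency_height)
    have "(x t)^2 + (y t)^2 = ((sin t)^2 + (cos t)^2) * ((f t)^2 + (- f' t)^2)"
      unfolding x_def y_def by (simp add: power2_eq_square algebra_simps del: sin_cos_squared_add sin_cos_squared_add2 sin_cos_squared_add3)
    then have xy: "(x t)^2 + (y t)^2 = (f t)^2 + (- f' t)^2" by simp
    have inner: "x t * p + y t * q = f t * P t + (- f' t) * Q t"
      unfolding x_def y_def P_def Q_def by (simp add: algebra_simps)
    have "(P t)^2 + (Q t)^2 = ((sin t)^2 + (cos t)^2) * (p^2 + q^2)"
      unfolding P_def Q_def by (simp add: power2_eq_square algebra_simps del: sin_cos_squared_add sin_cos_squared_add2 sin_cos_squared_add3)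
    then have PQ: "(P t)^2 + (Q t)^2 = p^2 + q^2" by simp
    show "a^2 * ((f t)^2 + (- f' t)^2) - (f t * P t + (- f' t) * Q t)^2 = a^2 * (a^2 - (P t)^2 - (Q t)^2)"
      using N[OF t] PQ unfolding N_def xy inner by (simp add: algebra_simps)
    have "x t * sin t + y t * cos t = ((sin t)^2 + (cos t)^2) * (- f' t)"
      unfolding x_def y_def by (simp add: power2_eq_square algebra_simps del: sin_cos_squared_add sin_cos_squared_add2 sin_cos_squared_add3)
    then have "x t * sin t + y t * cos t = - f' t" by simp
    then show "a^2 * (- f' t) = (f t * P t + (- f' t) * Q t) * Q t"
      using tangent[OF t] k unfolding inner Q_def[symmetric] by simp
    show "(P t)^2 + (Q t)^2 < a^2" unfolding PQ by (rule pq)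
  qed
  show ?thesis
  proof (cases "\<forall>t\<in>U. (f t)^2 = a^2 - (Q t)^2")
    case True
    have "(f t)^2 = (p^2 - q^2) * (cos t)^2 + (- 2 * p * q) * (cos t * sin t) + (a^2 - p^2)" if "t \<in> U" for t
    proof -
      have "(Q t)^2 = p^2 * (sin t)^2 + 2 * p * q * (cos t * sin t) + q^2 * (cos t)^2"
        unfolding Q_def by (simp add: power2_eq_square algebra_simps)
      then have "(f t)^2 = a^2 - (p^2 * (1 - (cos t)^2) + 2 * p * q * (cos t * sin t) + q^2 * (cos t)^2)"
        using True that unfolding sin_squared_eq by simp
      then show ?thesis by (simp add: algebra_simps)
    qed
    then show ?thesis using U by blast
  next
    case False
    \<comment> \<open>Where the support formula fails, \<open>height\<close> forces k = 0. As this
      set is open, the envelope point is constant on an interval.\<close>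
    define V where "V = (\<lambda>t. (f t)^2 - (a^2 - (Q t)^2)) -` (- {0}) \<inter> U"
    have "continuous_on U f"
      using f DERIV_isCont by (blast intro: continuous_at_imp_continuous_on)
    then have "continuous_on U (\<lambda>t. (f t)^2 - (a^2 - (Q t)^2))"
      unfolding Q_def by (intro continuous_intros)
    then have "open V"
      unfolding V_def using U(1) continuous_on_open_vimage by blast
    moreover obtain t0 where t0: "t0 \<in> V"
      using False unfolding V_def by auto
    ultimately obtain e where e: "e > 0" "{t0 - e<..<t0 + e} \<subseteq> V"
      using open_real_contains_Ioo by blast
    let ?I = "{t0 - e<..<t0 + e}"
    have tU: "t \<in> U" and k0: "k t = 0" if t: "t \<in> ?I" for t
    proof -
      have "t \<in> V" using e(2) t by blast
      then have "t \<in> U" and "(f t)^2 - (a^2 - (Q t)^2) \<noteq> 0"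
        unfolding V_def by auto
      then show "t \<in> U" "k t = 0"
        using height[of t] by auto
    qed
    have "(x has_real_derivative 0) (at t)" "(y has_real_derivative 0) (at t)" if "t \<in> ?I" for t
      using x'[OF tU[OF that]] y'[OF tU[OF that]] k0[OF that] by simp_all
    then have "x t = x t0" "y t = y t0" if "t \<in> ?I" for t
      using DERIV_isconst3[of "t0 - e" "t0 + e" t t0] e(1) that by auto
    moreover have "f t = cos t * x t - sin t * y t" for t
    proof -
      have "cos t * x t - sin t * y t = ((sin t)^2 + (cos t)^2) * f t"
        unfolding x_def y_def by (simp add: power2_eq_square algebra_simps del: sin_cos_squared_add sin_cos_squared_add2 sin_cos_squared_add3)
      then show ?thesis by simp
    qed
    ultimately have "(f t)^2 = (cos t * x t0 - sin t * y t0)^2" if "t \<in> ?I" for t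
      using that by metis
    from support_square_of_const_point[OF this]
    obtain \<alpha> \<beta> \<gamma> where "\<forall>t\<in>?I. (f t)^2 = \<alpha> * (cos t)^2 + \<beta> * (cos t * sin t) + \<gamma>" by blast
    moreover have "open ?I" "?I \<noteq> {}" "?I \<subseteq> U" using e tU by auto
    ultimately show ?thesis by blast
  qed
qed

lemma closed_centered_ellipse:
  assumes "centered_ellipse E" shows "closed E"
proof -
  have "closed {z. cmod (z - w) + cmod (z + w) = 2 * a}" for w a
    by (intro closed_Collect_eq continuous_intros)
  then show ?thesis
    using assms unfolding centered_ellipse_def by auto
qed

text \<open>The envelope point could keep changing between the pieces of the curve. These are
  finitely many closed sets, so on a smaller open set of angles it stays in one of them.\<close>

lemma support_square_on_three_ellipses:
  fixes f f' f'' :: "real \<Rightarrow> real"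
  assumes K: "three_ellipses_and_origin K" and U: "open U" "U \<noteq> {}"
    and f: "\<And>t. t \<in> U \<Longrightarrow> (f has_real_derivative f' t) (at t)"
    and f': "\<And>t. t \<in> U \<Longrightarrow> (f' has_real_derivative f'' t) (at t)"
    and on: "\<And>t. t \<in> U \<Longrightarrow> cis (- t) * Complex (f t) (- f' t) \<in> K"
  shows "\<exists>V \<alpha> \<beta> \<gamma>. open V \<and> V \<noteq> {} \<and> V \<subseteq> U \<and>
    (\<forall>t\<in>V. (f t)^2 = \<alpha> * (cos t)^2 + \<beta> * (cos t * sin t) + \<gamma>)"
proof -
  let ?z = "\<lambda>t. cis (- t) * Complex (f t) (- f' t)"
  obtain E1 E2 E3 where E: "centered_ellipse E1" "centered_ellipse E2" "centered_ellipse E3"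
    and KE: "K = E1 \<union> E2 \<union> E3 \<union> {0}"
    using K unfolding three_ellipses_and_origin_def by blast
  have "continuous_on U f" "continuous_on U f'"
    using f f' DERIV_isCont by (blast intro: continuous_at_imp_continuous_on)+
  then have "continuous_on U ?z"
    unfolding cis_conv_exp Complex_eq by (intro continuous_intros)
  moreover have "?z ` U \<subseteq> \<Union>{E1, E2, E3, {0}}"
    using on unfolding KE by blast
  moreover have "closed S" if "S \<in> {E1, E2, E3, {0}}" for S
    using that E closed_centered_ellipse by auto
  ultimately obtain S V where S: "S \<in> {E1, E2, E3, {0}}" and V: "open V" "V \<noteq> {}" "V \<subseteq> U"
    and zS: "?z ` V \<subseteq> S"
    using finite_closed_cover_open_subset[of "{E1, E2, E3, {0}}" U ?z] U by blast
  have ff: "f t = cos t * Re v - sin t * Im v" if "?z t = v" for t v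
  proof -
    have "f t = Re (cis t * ?z t)" by (simp add: mult.assoc[symmetric] cis_mult)
    then show ?thesis unfolding that by simp
  qed
  \<comment> \<open>The second case unites the degenerate ellipses with the origin, for which w =
    0.\<close>
  consider w a where "cmod w < a" "S = {z. cmod (z - w) + cmod (z + w) = 2 * a}"
    | w where "S \<subseteq> {w, - w}"
    using S E unfolding centered_ellipse_def by blast
  then show ?thesis
  proof cases
    case 1
    have "\<exists>V' \<alpha> \<beta> \<gamma>. open V' \<and> V' \<noteq> {} \<and> V' \<subseteq> V \<and>
      (\<forall>t\<in>V'. (f t)^2 = \<alpha> * (cos t)^2 + \<beta> * (cos t * sin t) + \<gamma>)"
      by (rule support_square_on_ellipse[OF V(1,2) 1(1), of f f' f'']) (use V(3) f f' zS 1(2) in auto)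
    then show ?thesis using V(3) by (meson subset_trans)
  next
    case 2
    have "(f t)^2 = (cos t * Re w - sin t * Im w)^2" if "t \<in> V" for t
    proof -
      have "?z t = w \<or> ?z t = - w" using 2 zS that by auto
      then have "f t = cos t * Re w - sin t * Im w \<or> f t = - (cos t * Re w - sin t * Im w)"
        using ff[of t w] ff[of t "- w"] by auto
      then show ?thesis by (simp only: power2_eq_iff)
    qed
    from support_square_of_const_point[OF this] obtain \<alpha> \<beta> \<gamma>
      where "\<forall>t\<in>V. (f t)^2 = \<alpha> * (cos t)^2 + \<beta> * (cos t * sin t) + \<gamma>" by blast
    then show ?thesis using V by (intro exI conjI)
  qed
qed

section \<open>Roots of the cubic\<close>

text \<open>After division by \<open>(cos t)^6\<close> the hypothesis is a polynomial identity in \<open>T = tan t\<close>. At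
  \<open>T = \<i>\<close>, where \<open>1 + T^2 = 0\<close>, all terms with \<open>\<xi>\<close> disappear and what remains is
  \<open>(z - 2) * (z^2 - 4 * z + 2) = 0\<close> for \<open>z = \<alpha> + \<i> * \<beta>\<close>. As this cubic has real roots only, \<open>\<beta> = 0\<close>.\<close>

lemma quadratic_form_roots:
  assumes V: "open V" "V \<noteq> {}" "V \<subseteq> {0<..<pi/2}"
    and root: "\<And>t. t \<in> V \<Longrightarrow>
      kcubic (\<lambda>j. \<xi> j + (cos t)^2) (\<alpha> * (cos t)^2 + \<beta> * (cos t * sin t) + \<gamma>) = 0"
  shows "\<beta> = 0" "\<alpha> \<in> {2, 2 + sqrt 2, 2 - sqrt 2}" "\<And>u. kcubic (\<lambda>j. \<xi> j + u) (\<alpha> * u + \<gamma>) = 0"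
proof -
  obtain s l q m n r where kc: "\<And>u z. kcubic (\<lambda>j. \<xi> j + u) z =
      z^3 - (s + 6 * u) * z^2 + (q + l * u + 10 * u^2) * z - (r + n * u + m * u^2 + 4 * u^3)"
    using kcubic_shift[of \<xi>] by blast
  have inf: "infinite V" using V open_real_infinite by blast
  define c where "c = complex_of_real"
  \<comment> \<open>As polynomials in tan t, \<open>Z\<close> is the quadratic form divided by (cos
    t)^2 and \<open>W\<close> is 1 / (cos t)^2.\<close>
  define Z where "Z = [:c \<alpha> + c \<gamma>, c \<beta>, c \<gamma>:]"
  define W where "W = [:1, 0, 1::complex:]"
  define \<Phi> where "\<Phi> = Z^3 - ([:6:] + smult (c s) W) * Z^2
      + ([:10:] + smult (c l) W + smult (c q) (W^2)) * Z
      - ([:4:] + smult (c m) W + smult (c n) (W^2) + smult (c r) (W^3))"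
  have "poly \<Phi> (complex_of_real (tan t)) = 0" if t: "t \<in> V" for t
  proof -
    define T where "T = tan t"
    define C where "C = (cos t)^2"
    define U where "U = 1 + T^2"
    define z where "z = \<alpha> + \<beta> * T + \<gamma> * U"
    have cos: "cos t > 0" using t V(3) cos_gt_zero[of t] by auto
    have CU: "C * U = 1"
      using cos by (simp add: C_def U_def T_def tan_def power_divide distrib_left)
    have "C * T = cos t * sin t"
      using cos by (simp add: C_def T_def tan_def power2_eq_square)
    moreover have "C * z = \<alpha> * C + \<beta> * (C * T) + \<gamma> * (C * U)"
      by (simp add: z_def algebra_simps)
    ultimately have Cz: "C * z = \<alpha> * (cos t)^2 + \<beta> * (cos t * sin t) + \<gamma>"
      unfolding CU by (simp add: C_def)
    have "C^3 * (z^3 - (6 + s * U) * z^2 + (10 + l * U + q * U^2) * z - (4 + m * U + n * U^2 + r * U^3))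
      = (C * z)^3 - (s * (C * U) + 6 * C) * (C * z)^2 + (q * (C * U)^2 + l * (C * U) * C + 10 * C^2) * (C * z)
        - (r * (C * U)^3 + n * (C * U)^2 * C + m * (C * U) * C^2 + 4 * C^3)"
      by (simp add: power2_eq_square power3_eq_cube algebra_simps)
    also have "\<dots> = kcubic (\<lambda>j. \<xi> j + C) (C * z)"
      unfolding CU kc by simp
    also have "\<dots> = 0"
      unfolding Cz using root[OF t] by (simp add: C_def)
    finally have "z^3 - (6 + s * U) * z^2 + (10 + l * U + q * U^2) * z - (4 + m * U + n * U^2 + r * U^3) = 0"
      using cos by (simp add: C_def)
    then have "c (z^3 - (6 + s * U) * z^2 + (10 + l * U + q * U^2) * z - (4 + m * U + n * U^2 + r * U^3)) = 0"
      by (simp add: c_def)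
    moreover have "poly Z (c T) = c z" "poly W (c T) = c U"
      by (simp_all add: Z_def W_def z_def U_def c_def power2_eq_square algebra_simps)
    ultimately show ?thesis
      unfolding \<Phi>_def T_def[symmetric] c_def[symmetric] by (simp add: c_def)
  qed
  then have sub: "(\<lambda>t. complex_of_real (tan t)) ` V \<subseteq> {x. poly \<Phi> x = 0}" by blast
  have "inj_on tan V"
  proof (rule inj_onI)
    fix x y assume "x \<in> V" "y \<in> V" and eq: "tan x = tan y"
    then have "- (pi/2) < x" "x < pi/2" "- (pi/2) < y" "y < pi/2"
      using V(3) pi_gt_zero by fastforce+
    then show "x = y"
      using tan_monotone[of x y] tan_monotone[of y x] eq by (metis less_irrefl linorder_neqE_linordered_idom)
  qed
  then have "inj_on (\<lambda>t. complex_of_real (tan t)) V"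
    by (simp add: inj_on_def)
  with inf have "infinite ((\<lambda>t. complex_of_real (tan t)) ` V)"
    by (simp add: finite_image_iff)
  with sub have "\<Phi> = 0"
    using poly_roots_finite[of \<Phi>] finite_subset by blast
  then have "poly \<Phi> \<i> = 0" by simp
  moreover have "poly W \<i> = 0" "poly Z \<i> = Complex \<alpha> \<beta>"
    by (simp_all add: W_def Z_def c_def complex_eq_iff)
  ultimately have "(Complex \<alpha> \<beta>)^3 - 6 * (Complex \<alpha> \<beta>)^2 + 10 * Complex \<alpha> \<beta> - 4 = 0"
    by (simp add: \<Phi>_def)
  moreover have "z^3 - 6 * z^2 + 10 * z - 4 = (z - 2) * (z - (2 + c (sqrt 2))) * (z - (2 - c (sqrt 2)))" for z
  proof -
    have "c (sqrt 2) * c (sqrt 2) = 2"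
      unfolding c_def of_real_mult[symmetric] by simp
    then have s2: "(c (sqrt 2))^2 = 2" by (simp add: power2_eq_square)
    have "(z - 2) * (z - (2 + c (sqrt 2))) * (z - (2 - c (sqrt 2)))
        = (z - 2) * ((z - 2)^2 - (c (sqrt 2))^2)"
      by (simp add: power2_eq_square algebra_simps)
    then show ?thesis
      unfolding s2 by (simp add: power2_eq_square power3_eq_cube algebra_simps)
  qed
  ultimately have "Complex \<alpha> \<beta> = 2 \<or> Complex \<alpha> \<beta> = 2 + c (sqrt 2) \<or> Complex \<alpha> \<beta> = 2 - c (sqrt 2)"
    by simp
  then show \<beta>: "\<beta> = 0" and "\<alpha> \<in> {2, 2 + sqrt 2, 2 - sqrt 2}"
    by (auto simp: complex_eq_iff c_def)
  \<comment> \<open>Now that the mixed term is gone, the root depends on u = (cos t)^2 alone, and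
    the identity extends from the angles in \<open>V\<close> to all u.\<close>
  define \<Psi> where "\<Psi> = [:\<gamma>, \<alpha>:]^3 - [:s, 6:] * [:\<gamma>, \<alpha>:]^2 + [:q, l, 10:] * [:\<gamma>, \<alpha>:] - [:r, n, m, 4:]"
  have \<Psi>: "poly \<Psi> u = kcubic (\<lambda>j. \<xi> j + u) (\<alpha> * u + \<gamma>)" for u
    unfolding kc \<Psi>_def by (simp add: power2_eq_square power3_eq_cube algebra_simps)
  have "(\<lambda>t. (cos t)^2) ` V \<subseteq> {x. poly \<Psi> x = 0}"
    using root unfolding \<Psi> \<beta> by auto
  moreover have "inj_on (\<lambda>t. (cos t)^2) V"
  proof (rule inj_onI)
    fix x y assume xy: "x \<in> V" "y \<in> V" and eq: "(cos x)^2 = (cos y)^2"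
    have "cos x > 0" "cos y > 0" using xy V(3) cos_gt_zero by fastforce+
    then have "cos x = cos y" using eq by (simp add: power2_eq_iff_nonneg)
    then show "x = y" using xy V(3) cos_inj_pi[of x y] by fastforce
  qed
  then have "infinite ((\<lambda>t. (cos t)^2) ` V)"
    using inf by (simp add: finite_image_iff)
  ultimately have "\<Psi> = 0"
    using poly_roots_finite[of \<Psi>] finite_subset by blast
  then show "kcubic (\<lambda>j. \<xi> j + u) (\<alpha> * u + \<gamma>) = 0" for u
    using \<Psi>[of u] by simp
qed

section \<open>Smooth dependence of separated roots on the angle\<close>

lemma isCont_separated_root:
  fixes \<zeta> \<eta> \<omega> F :: "real \<Rightarrow> real"
  assumes U: "open U" "t0 \<in> U" and F: "isCont F t0"
    and fac: "\<And>t. t \<in> U \<Longrightarrow> F t = (\<zeta> t0 - \<zeta> t) * (\<zeta> t0 - \<eta> t) * (\<zeta> t0 - \<omega> t)"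
    and d: "d > 0" "\<And>t. t \<in> U \<Longrightarrow> d \<le> \<bar>\<zeta> t0 - \<eta> t\<bar>" "\<And>t. t \<in> U \<Longrightarrow> d \<le> \<bar>\<zeta> t0 - \<omega> t\<bar>"
  shows "isCont \<zeta> t0"
proof -
  have "F t0 = 0" using fac[OF U(2)] by simp
  then have F0: "(F \<longlongrightarrow> 0) (at t0)" using F by (simp add: isCont_def)
  \<comment> \<open>\<open>F t\<close> is the cubic of angle t at the root of angle t0. Its other
    two factors are at least d in size, so it controls the displacement of the root.\<close>
  have "\<forall>\<^sub>F t in at t0. norm (\<zeta> t - \<zeta> t0) \<le> norm (F t) * (1 / d^2)"
  proof -
    have "\<forall>\<^sub>F t in at t0. t \<in> U"
      using U eventually_at_topological by blast
    then show ?thesis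
    proof eventually_elim
      case (elim t)
      have "\<bar>\<zeta> t - \<zeta> t0\<bar> * (d * d) \<le> \<bar>\<zeta> t - \<zeta> t0\<bar> * (\<bar>\<zeta> t0 - \<eta> t\<bar> * \<bar>\<zeta> t0 - \<omega> t\<bar>)"
        using d elim by (intro mult_left_mono mult_mono) auto
      also have "\<dots> = \<bar>F t\<bar>"
        unfolding fac[OF elim] by (simp add: abs_mult abs_minus_commute)
      finally show ?case using d(1) by (simp add: field_simps power2_eq_square)
    qed
  qed
  then have "((\<lambda>t. \<zeta> t - \<zeta> t0) \<longlongrightarrow> 0) (at t0)"
    using F0 by (rule tendsto_0_le[rotated])
  then show ?thesis
    unfolding isCont_def by (simp add: LIM_zero_iff)
qed

text \<open>Implicit differentiation by hand: the factorization expresses the difference quotient of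
  \<zeta> by that of \<open>F\<close>, divided by two factors that converge because the other roots
  are continuous.\<close>

lemma DERIV_separated_root:
  fixes \<zeta> \<eta> \<omega> F :: "real \<Rightarrow> real"
  assumes U: "open U" "t0 \<in> U" and F: "(F has_real_derivative D) (at t0)"
    and fac: "\<And>t. t \<in> U \<Longrightarrow> F t = (\<zeta> t0 - \<zeta> t) * (\<zeta> t0 - \<eta> t) * (\<zeta> t0 - \<omega> t)"
    and ne: "\<And>t. t \<in> U \<Longrightarrow> \<zeta> t0 \<noteq> \<eta> t" "\<And>t. t \<in> U \<Longrightarrow> \<zeta> t0 \<noteq> \<omega> t"
    and cont: "isCont \<eta> t0" "isCont \<omega> t0"
  shows "(\<zeta> has_real_derivative - D / ((\<zeta> t0 - \<eta> t0) * (\<zeta> t0 - \<omega> t0))) (at t0)"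
proof -
  have F0: "F t0 = 0" using fac[OF U(2)] by simp
  have "((\<lambda>y. (F y - F t0) / (y - t0)) \<longlongrightarrow> D) (at t0)"
    using F by (simp add: has_field_derivative_iff)
  moreover have "((\<lambda>t. (\<zeta> t0 - \<eta> t) * (\<zeta> t0 - \<omega> t)) \<longlongrightarrow> (\<zeta> t0 - \<eta> t0) * (\<zeta> t0 - \<omega> t0)) (at t0)"
    using cont unfolding isCont_def by (intro tendsto_intros)
  moreover have "(\<zeta> t0 - \<eta> t0) * (\<zeta> t0 - \<omega> t0) \<noteq> 0"
    using ne U(2) by simp
  ultimately have lim: "((\<lambda>y. - ((F y - F t0) / (y - t0)) / ((\<zeta> t0 - \<eta> y) * (\<zeta> t0 - \<omega> y)))
      \<longlongrightarrow> - D / ((\<zeta> t0 - \<eta> t0) * (\<zeta> t0 - \<omega> t0))) (at t0)"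
    by (intro tendsto_divide tendsto_minus)
  have "\<forall>\<^sub>F t in at t0. t \<in> U"
    using U eventually_at_topological by blast
  then have "\<forall>\<^sub>F y in at t0. - ((F y - F t0) / (y - t0)) / ((\<zeta> t0 - \<eta> y) * (\<zeta> t0 - \<omega> y))
      = (\<zeta> y - \<zeta> t0) / (y - t0)"
  proof eventually_elim
    case (elim y)
    have "- ((F y - F t0) / (y - t0)) / ((\<zeta> t0 - \<eta> y) * (\<zeta> t0 - \<omega> y))
      = (- F y / ((\<zeta> t0 - \<eta> y) * (\<zeta> t0 - \<omega> y))) / (y - t0)"
      unfolding F0 by (simp add: field_simps)
    also have "- F y / ((\<zeta> t0 - \<eta> y) * (\<zeta> t0 - \<omega> y)) = \<zeta> y - \<zeta> t0"
      unfolding fac[OF elim] mult.assoc using ne[OF elim] by simp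
    finally show ?case .
  qed
  with lim show ?thesis
    unfolding has_field_derivative_iff by (rule Lim_transform_eventually)
qed

text \<open>Dividing the differences of the three equations by the differences of the roots yields
  the relations of Vieta.\<close>

lemma monic_cubic_factorization:
  fixes a b c x y w :: real
  assumes "x \<noteq> y" "x \<noteq> w" "y \<noteq> w"
    and x: "x^3 - a * x^2 + b * x - c = 0" and y: "y^3 - a * y^2 + b * y - c = 0"
    and w: "w^3 - a * w^2 + b * w - c = 0"
  shows "z^3 - a * z^2 + b * z - c = (z - x) * (z - y) * (z - w)"
proof -
  have "(x - y) * (x^2 + x * y + y^2 - a * (x + y) + b) = 0"
    using x y by (simp add: power2_eq_square power3_eq_cube algebra_simps)
  then have xy: "x^2 + x * y + y^2 - a * (x + y) + b = 0" using assms(1) by simp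
  have "(x - w) * (x^2 + x * w + w^2 - a * (x + w) + b) = 0"
    using x w by (simp add: power2_eq_square power3_eq_cube algebra_simps)
  then have xw: "x^2 + x * w + w^2 - a * (x + w) + b = 0" using assms(2) by simp
  have "(y - w) * (x + y + w - a) = 0"
    using xy xw by (simp add: power2_eq_square algebra_simps)
  then have a: "a = x + y + w" using assms(3) by simp
  have b: "b = x * y + x * w + y * w"
    using xy unfolding a by (simp add: power2_eq_square algebra_simps)
  have c: "c = x * y * w"
    using x unfolding a b by (simp add: power2_eq_square power3_eq_cube algebra_simps)
  show ?thesis
    unfolding a b c by (simp add: power2_eq_square power3_eq_cube algebra_simps)
qed

text \<open>Strict positivity of the weights makes the interlacing strict. The resulting strict
  signs, unlike the mere existence of three roots, persist when the weights change slightly.\<close>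

lemma kcubic_sign_changes:
  assumes pos: "\<And>j. j \<in> {1..6} \<Longrightarrow> y j > 0"
  obtains r1 r2 M where "0 < r1" "r1 < r2" "r2 < M"
    "kcubic y 0 < 0" "kcubic y r1 > 0" "kcubic y r2 < 0" "kcubic y M > 0"
proof -
  have y: "y 1 > 0" "y 2 > 0" "y 3 > 0" "y 4 > 0" "y 5 > 0" "y 6 > 0"
    using pos by simp_all
  \<comment> \<open>Sturm: \<open>d\<close> and \<open>z - s\<close> belong to the leading minors of sizes 5 and 3, whose roots interlace.\<close>
  define s where "s = y 1 + y 2"
  define S where "S = s + y 3 + y 4"
  define P where "P = y 1 * y 3 + y 1 * y 4 + y 2 * y 4"
  define d where "d z = z^2 - S * z + P" for z :: real
  have P: "P > 0" unfolding P_def using y by (intro add_pos_pos mult_pos_pos)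
  have kd: "kcubic y z = (z - y 5 - y 6) * d z - y 4 * y 5 * (z - s)" for z
    unfolding kcubic_unfold d_def S_def s_def P_def
    by (simp add: power2_eq_square power3_eq_cube algebra_simps)
  have cont: "continuous_on A d" for A
    unfolding d_def by (intro continuous_intros)
  have d0: "d 0 > 0" and dS: "d S > 0"
    using P by (simp_all add: d_def power2_eq_square)
  have "d s = - (y 2 * y 3)"
    unfolding d_def S_def s_def P_def by (simp add: power2_eq_square algebra_simps)
  then have ds: "d s < 0" using y by simp
  have sS: "0 < s" "s < S" using y by (simp_all add: s_def S_def)
  obtain r1 where r1: "0 \<le> r1" "r1 \<le> s" "d r1 = 0"
    using IVT2'[of d s 0 0] d0 ds sS cont by force
  obtain r2 where r2: "s \<le> r2" "r2 \<le> S" "d r2 = 0"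
    using IVT'[of d s 0 S] dS ds sS cont by force
  have "r1 \<noteq> 0" "r1 \<noteq> s" "r2 \<noteq> s" using r1 r2 d0 ds by auto
  then have r: "0 < r1" "r1 < s" "s < r2" using r1 r2 by auto
  define e where "e = y 1 + y 2 + y 3 + y 4 + y 5 + y 6"
  define e2 where "e2 = y 1 * (y 3 + y 4 + y 5 + y 6) + y 2 * (y 4 + y 5 + y 6) + y 3 * (y 5 + y 6) + y 4 * y 6"
  define e3 where "e3 = y 1 * y 3 * y 5 + y 1 * y 3 * y 6 + y 1 * y 4 * y 6 + y 2 * y 4 * y 6"
  have e: "e > 0" "e2 > 0" "e3 > 0"
    unfolding e_def e2_def e3_def using y by (auto intro!: add_pos_pos mult_pos_pos)
  have kc: "kcubic y z = z^2 * (z - e) + e2 * z - e3" for z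
    unfolding kcubic_unfold e_def e2_def e3_def by (simp add: power2_eq_square power3_eq_cube algebra_simps)
  \<comment> \<open>With M >= 1 and M - e = 1 + e3, the leading part M^2 (M - e) exceeds e3.\<close>
  define M where "M = 1 + e + e3"
  have M: "M \<ge> 1" using e by (simp add: M_def)
  have "M^2 * (M - e) \<ge> 1 * (1 + e3)"
    using M e by (intro mult_mono) (auto simp: M_def one_le_power)
  moreover have "e2 * M > 0" using e M by simp
  ultimately have kM: "kcubic y M > 0" unfolding kc by simp
  have k0: "kcubic y 0 < 0" unfolding kc using e by simp
  have kr: "kcubic y r1 > 0" "kcubic y r2 < 0"
    unfolding kd r1(3) r2(3) using r y by (simp_all add: mult_pos_neg)
  have "r2 < M"
    using r2(2) y e unfolding M_def e_def S_def s_def by linarith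
  show ?thesis
    by (rule that[OF r(1) less_trans[OF r(2,3)] \<open>r2 < M\<close> k0 kr kM])
qed

text \<open>The separators r1 and r2 do not move with t, so the distance from a root at
  \<open>t0\<close> to the other two roots at t has a lower bound independent of t.\<close>

lemma separated_roots_isCont:
  fixes F :: "real \<Rightarrow> real \<Rightarrow> real" and \<zeta> \<eta> \<omega> :: "real \<Rightarrow> real"
  assumes U: "open U" "t0 \<in> U" and F: "\<And>z. isCont (\<lambda>t. F t z) t0"
    and fac: "\<And>t z. t \<in> U \<Longrightarrow> F t z = (z - \<zeta> t) * (z - \<eta> t) * (z - \<omega> t)"
    and ord: "\<And>t. t \<in> U \<Longrightarrow> \<zeta> t < r1 \<and> r1 < \<eta> t \<and> \<eta> t < r2 \<and> r2 < \<omega> t"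
  shows "isCont \<zeta> t0" "isCont \<eta> t0" "isCont \<omega> t0"
proof -
  note o0 = ord[OF U(2)]
  show "isCont \<zeta> t0"
  proof (rule isCont_separated_root[OF U F])
    show "F t (\<zeta> t0) = (\<zeta> t0 - \<zeta> t) * (\<zeta> t0 - \<eta> t) * (\<zeta> t0 - \<omega> t)" if "t \<in> U" for t
      by (rule fac[OF that])
    show "r1 - \<zeta> t0 > 0" using o0 by simp
    show "r1 - \<zeta> t0 \<le> \<bar>\<zeta> t0 - \<eta> t\<bar>" "r1 - \<zeta> t0 \<le> \<bar>\<zeta> t0 - \<omega> t\<bar>" if "t \<in> U" for t
      using ord[OF that] by linarith+
  qed
  show "isCont \<eta> t0"
  proof (rule isCont_separated_root[OF U F])
    show "F t (\<eta> t0) = (\<eta> t0 - \<eta> t) * (\<eta> t0 - \<zeta> t) * (\<eta> t0 - \<omega> t)" if "t \<in> U" for t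
      by (simp add: fac[OF that])
    show "min (\<eta> t0 - r1) (r2 - \<eta> t0) > 0" using o0 by simp
    show "min (\<eta> t0 - r1) (r2 - \<eta> t0) \<le> \<bar>\<eta> t0 - \<zeta> t\<bar>"
      "min (\<eta> t0 - r1) (r2 - \<eta> t0) \<le> \<bar>\<eta> t0 - \<omega> t\<bar>" if "t \<in> U" for t
      using ord[OF that] by linarith+
  qed
  show "isCont \<omega> t0"
  proof (rule isCont_separated_root[OF U F])
    show "F t (\<omega> t0) = (\<omega> t0 - \<omega> t) * (\<omega> t0 - \<zeta> t) * (\<omega> t0 - \<eta> t)" if "t \<in> U" for t
      by (simp add: fac[OF that])
    show "\<omega> t0 - r2 > 0" using o0 by simp
    show "\<omega> t0 - r2 \<le> \<bar>\<omega> t0 - \<zeta> t\<bar>" "\<omega> t0 - r2 \<le> \<bar>\<omega> t0 - \<eta> t\<bar>" if "t \<in> U" for t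
      using ord[OF that] by linarith+
  qed
qed

lemma separated_roots_DERIV:
  fixes F D :: "real \<Rightarrow> real \<Rightarrow> real" and \<zeta> \<eta> \<omega> :: "real \<Rightarrow> real"
  assumes U: "open U" "t0 \<in> U" and F: "\<And>z. ((\<lambda>t. F t z) has_real_derivative D t0 z) (at t0)"
    and fac: "\<And>t z. t \<in> U \<Longrightarrow> F t z = (z - \<zeta> t) * (z - \<eta> t) * (z - \<omega> t)"
    and ord: "\<And>t. t \<in> U \<Longrightarrow> \<zeta> t < r1 \<and> r1 < \<eta> t \<and> \<eta> t < r2 \<and> r2 < \<omega> t"
  shows "(\<zeta> has_real_derivative - D t0 (\<zeta> t0) / ((\<zeta> t0 - \<eta> t0) * (\<zeta> t0 - \<omega> t0))) (at t0)"
    and "(\<eta> has_real_derivative - D t0 (\<eta> t0) / ((\<eta> t0 - \<zeta> t0) * (\<eta> t0 - \<omega> t0))) (at t0)"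
    and "(\<omega> has_real_derivative - D t0 (\<omega> t0) / ((\<omega> t0 - \<zeta> t0) * (\<omega> t0 - \<eta> t0))) (at t0)"
proof -
  note o0 = ord[OF U(2)]
  have ne: "\<zeta> t0 \<noteq> \<eta> t" "\<zeta> t0 \<noteq> \<omega> t" "\<eta> t0 \<noteq> \<zeta> t" "\<eta> t0 \<noteq> \<omega> t" "\<omega> t0 \<noteq> \<zeta> t" "\<omega> t0 \<noteq> \<eta> t"
    if "t \<in> U" for t
    using o0 ord[OF that] by linarith+
  note cont = separated_roots_isCont[OF U DERIV_isCont[OF F] fac ord]
  show "(\<zeta> has_real_derivative - D t0 (\<zeta> t0) / ((\<zeta> t0 - \<eta> t0) * (\<zeta> t0 - \<omega> t0))) (at t0)"
    by (rule DERIV_separated_root[OF U F _ _ _ cont(2,3)]) (simp_all add: fac ne)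
  show "(\<eta> has_real_derivative - D t0 (\<eta> t0) / ((\<eta> t0 - \<zeta> t0) * (\<eta> t0 - \<omega> t0))) (at t0)"
    by (rule DERIV_separated_root[OF U F _ _ _ cont(1,3)]) (simp_all add: fac ne)
  show "(\<omega> has_real_derivative - D t0 (\<omega> t0) / ((\<omega> t0 - \<zeta> t0) * (\<omega> t0 - \<eta> t0))) (at t0)"
    by (rule DERIV_separated_root[OF U F _ _ _ cont(1,2)]) (simp_all add: fac ne)
qed

text \<open>The support function is the square root of a root of the cubic, and the velocity of the
  envelope point involves its second derivative.\<close>

lemma sqrt_twice_differentiable:
  fixes \<rho> E :: "real \<Rightarrow> real"
  assumes \<rho>: "\<And>t. t \<in> U \<Longrightarrow> (\<rho> has_real_derivative E t) (at t)" and pos: "\<And>t. t \<in> U \<Longrightarrow> \<rho> t > 0"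
    and E: "\<And>t. t \<in> U \<Longrightarrow> E differentiable (at t)"
  shows "\<exists>f' f''. \<forall>t\<in>U. ((\<lambda>t. sqrt (\<rho> t)) has_real_derivative f' t) (at t) \<and> (f' has_real_derivative f'' t) (at t)"
proof -
  define f' where "f' t = E t / (2 * sqrt (\<rho> t))" for t
  have d: "((\<lambda>t. sqrt (\<rho> t)) has_real_derivative f' t) (at t)" if "t \<in> U" for t
    unfolding f'_def using pos[OF that]
    by (auto intro!: derivative_eq_intros \<rho>[OF that] simp: field_simps)
  have "f' differentiable (at t)" if t: "t \<in> U" for t
  proof -
    have "(\<lambda>t. sqrt (\<rho> t)) differentiable (at t)"
      using d[OF t] real_differentiable_def by blast
    then have "(\<lambda>t. 2 * sqrt (\<rho> t)) differentiable (at t)"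
      by simp
    then show ?thesis
      unfolding f'_def using E[OF t] pos[OF t] by (intro differentiable_divide) auto
  qed
  then have "\<forall>t\<in>U. \<exists>D. (f' has_real_derivative D) (at t)"
    by (simp add: real_differentiable_def)
  then obtain f'' where "\<forall>t\<in>U. (f' has_real_derivative f'' t) (at t)"
    by (auto simp: bchoice_iff)
  with d show ?thesis by blast
qed

lemma kcubic_smooth_roots:
  assumes \<xi>: "\<And>j. j \<in> {1..6} \<Longrightarrow> \<xi> j \<ge> 0"
  obtains U \<zeta> \<eta> \<omega> where "open U" "U \<noteq> {}" "U \<subseteq> {0<..<pi/2}"
    "\<And>t. t \<in> U \<Longrightarrow> 0 < \<zeta> t \<and> \<zeta> t < \<eta> t \<and> \<eta> t < \<omega> t"
    "\<And>\<rho> t. \<rho> \<in> {\<zeta>, \<eta>, \<omega>} \<Longrightarrow> t \<in> U \<Longrightarrow> kcubic (\<lambda>j. \<xi> j + (cos t)^2) (\<rho> t) = 0"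
    "\<And>\<rho>. \<rho> \<in> {\<zeta>, \<eta>, \<omega>} \<Longrightarrow> \<exists>f' f''. \<forall>t\<in>U. ((\<lambda>t. sqrt (\<rho> t)) has_real_derivative f' t) (at t)
       \<and> (f' has_real_derivative f'' t) (at t)"
proof -
  obtain s l q m n r where kc: "\<And>u z. kcubic (\<lambda>j. \<xi> j + u) z =
      z^3 - (s + 6 * u) * z^2 + (q + l * u + 10 * u^2) * z - (r + n * u + m * u^2 + 4 * u^3)"
    using kcubic_shift[of \<xi>] by blast
  define F where "F t z = kcubic (\<lambda>j. \<xi> j + (cos t)^2) z" for t z
  define D where "D t z = - 2 * cos t * sin t * (- 6 * z^2 + (l + 20 * (cos t)^2) * z
      - (n + 2 * m * (cos t)^2 + 12 * (cos t)^4))" for t z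
  have dF: "((\<lambda>t. F t z) has_real_derivative D t z) (at t)" for t z
    unfolding F_def kc D_def
    by (auto intro!: derivative_eq_intros simp: power2_eq_square power3_eq_cube eval_nat_numeral algebra_simps)
  have contF: "continuous_on A (\<lambda>t. F t z)" for A z
    using dF DERIV_isCont by (blast intro: continuous_at_imp_continuous_on)
  have contz: "continuous_on A (F t)" for A t
    unfolding F_def kcubic_def by (intro continuous_intros)
  \<comment> \<open>Some \<xi> j may be 0, so an angle with nonzero cosine is needed to make all
    weights positive. Inside (0, pi/2), moreover, both tan and the square of cos are
    injective.\<close>
  have "cos (pi/4) > 0" by (simp add: cos_45)
  then have "\<xi> j + (cos (pi/4))^2 > 0" if "j \<in> {1..6}" for j
    using \<xi>[OF that] by (simp add: add_nonneg_pos)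
  then obtain r1 r2 M where rM: "0 < r1" "r1 < r2" "r2 < M"
    and sg: "F (pi/4) 0 < 0" "F (pi/4) r1 > 0" "F (pi/4) r2 < 0" "F (pi/4) M > 0"
    unfolding F_def using kcubic_sign_changes[of "\<lambda>j. \<xi> j + (cos (pi/4))^2"] by metis
  \<comment> \<open>The sign pattern at the separators chosen for pi/4 is an open condition on the
    angle.\<close>
  define U where "U = {0<..<pi/2} \<inter> ({t. F t 0 < 0} \<inter> {t. 0 < F t r1} \<inter> {t. F t r2 < 0} \<inter> {t. 0 < F t M})"
  have U: "open U"
    unfolding U_def by (intro open_Int open_greaterThanLessThan open_Collect_less contF continuous_on_const)
  have "pi/4 \<in> U" using sg pi_gt_zero by (simp add: U_def)
  then have Une: "U \<noteq> {}" by blast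
  have Usub: "U \<subseteq> {0<..<pi/2}" by (auto simp: U_def)
  have Usg: "F t 0 < 0" "F t r1 > 0" "F t r2 < 0" "F t M > 0" if "t \<in> U" for t
    using that by (simp_all add: U_def)
  have "\<exists>z. 0 < z \<and> z < r1 \<and> F t z = 0" if "t \<in> U" for t
    using IVT'[of "F t" 0 0 r1] Usg[OF that] rM contz by (metis less_eq_real_def less_irrefl)
  then obtain \<zeta> where \<zeta>: "\<And>t. t \<in> U \<Longrightarrow> 0 < \<zeta> t \<and> \<zeta> t < r1 \<and> F t (\<zeta> t) = 0" by metis
  have "\<exists>z. r1 < z \<and> z < r2 \<and> F t z = 0" if "t \<in> U" for t
    using IVT2'[of "F t" r2 0 r1] Usg[OF that] rM contz by (metis less_eq_real_def less_irrefl)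
  then obtain \<eta> where \<eta>: "\<And>t. t \<in> U \<Longrightarrow> r1 < \<eta> t \<and> \<eta> t < r2 \<and> F t (\<eta> t) = 0" by metis
  have "\<exists>z. r2 < z \<and> z < M \<and> F t z = 0" if "t \<in> U" for t
    using IVT'[of "F t" r2 0 M] Usg[OF that] rM contz by (metis less_eq_real_def less_irrefl)
  then obtain \<omega> where \<omega>: "\<And>t. t \<in> U \<Longrightarrow> r2 < \<omega> t \<and> \<omega> t < M \<and> F t (\<omega> t) = 0" by metis
  have ord: "\<zeta> t < r1 \<and> r1 < \<eta> t \<and> \<eta> t < r2 \<and> r2 < \<omega> t" if "t \<in> U" for t
    using \<zeta>[OF that] \<eta>[OF that] \<omega>[OF that] by blast
  have fac: "F t z = (z - \<zeta> t) * (z - \<eta> t) * (z - \<omega> t)" if t: "t \<in> U" for t z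
  proof -
    have "\<zeta> t \<noteq> \<eta> t" "\<zeta> t \<noteq> \<omega> t" "\<eta> t \<noteq> \<omega> t" using ord[OF t] by linarith+
    then show ?thesis
      using \<zeta>[OF t] \<eta>[OF t] \<omega>[OF t] unfolding F_def kcubic_def
      by (intro monic_cubic_factorization) auto
  qed
  note d = separated_roots_DERIV[where F = F and D = D, OF U _ dF fac ord]
  have D_diff: "(\<lambda>t. D t (\<rho> t)) differentiable (at t)" if "\<rho> differentiable (at t)" for \<rho> t
  proof -
    have "cos differentiable (at t)" "sin differentiable (at t)"
      using DERIV_cos DERIV_sin real_differentiable_def by blast+
    with that show ?thesis
      unfolding D_def by (intro differentiable_mult differentiable_diff differentiable_add
          differentiable_power differentiable_const differentiable_minus)
  qed
  have diff: "\<zeta> differentiable (at t)" "\<eta> differentiable (at t)" "\<omega> differentiable (at t)" if "t \<in> U" for t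
    using d[OF that] real_differentiable_def by blast+
  have twice: "\<exists>f' f''. \<forall>t\<in>U. ((\<lambda>t. sqrt (\<rho> t)) has_real_derivative f' t) (at t)
       \<and> (f' has_real_derivative f'' t) (at t)"
    if \<rho>: "\<And>t. t \<in> U \<Longrightarrow> (\<rho> has_real_derivative - D t (\<rho> t) / ((\<rho> t - \<sigma> t) * (\<rho> t - \<tau> t))) (at t)"
      and pos: "\<And>t. t \<in> U \<Longrightarrow> \<rho> t > 0"
      and dif: "\<And>t. t \<in> U \<Longrightarrow> \<rho> differentiable (at t)" "\<And>t. t \<in> U \<Longrightarrow> \<sigma> differentiable (at t)"
        "\<And>t. t \<in> U \<Longrightarrow> \<tau> differentiable (at t)"
      and ne: "\<And>t. t \<in> U \<Longrightarrow> \<rho> t \<noteq> \<sigma> t \<and> \<rho> t \<noteq> \<tau> t" for \<rho> \<sigma> \<tau> :: "real \<Rightarrow> real"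
  proof (rule sqrt_twice_differentiable[OF \<rho> pos])
    show "(\<lambda>t. - D t (\<rho> t) / ((\<rho> t - \<sigma> t) * (\<rho> t - \<tau> t))) differentiable (at t)" if "t \<in> U" for t
      using dif[OF that] ne[OF that]
      by (intro differentiable_divide differentiable_mult differentiable_diff differentiable_minus D_diff) auto
  qed
  have "\<zeta> t > 0" "\<eta> t > 0" "\<omega> t > 0" "\<zeta> t \<noteq> \<eta> t \<and> \<zeta> t \<noteq> \<omega> t" "\<eta> t \<noteq> \<zeta> t \<and> \<eta> t \<noteq> \<omega> t"
    "\<omega> t \<noteq> \<zeta> t \<and> \<omega> t \<noteq> \<eta> t" if "t \<in> U" for t
    using \<zeta>[OF that] ord[OF that] by linarith+
  note sep = this
  note smooth = twice[OF d(1) sep(1) diff(1,2,3) sep(4)] twice[OF d(2) sep(2) diff(2,1,3) sep(5)]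
    twice[OF d(3) sep(3) diff(3,1,2) sep(6)]
  show ?thesis
  proof (rule that[OF U Une Usub])
    show "0 < \<zeta> t \<and> \<zeta> t < \<eta> t \<and> \<eta> t < \<omega> t" if "t \<in> U" for t
      using \<zeta>[OF that] ord[OF that] by linarith
    show "kcubic (\<lambda>j. \<xi> j + (cos t)^2) (\<rho> t) = 0" if "\<rho> \<in> {\<zeta>, \<eta>, \<omega>}" "t \<in> U" for \<rho> t
      using that(1) \<zeta>[OF that(2)] \<eta>[OF that(2)] \<omega>[OF that(2)] unfolding F_def by auto
    show "\<exists>f' f''. \<forall>t\<in>U. ((\<lambda>t. sqrt (\<rho> t)) has_real_derivative f' t) (at t)
       \<and> (f' has_real_derivative f'' t) (at t)" if "\<rho> \<in> {\<zeta>, \<eta>, \<omega>}" for \<rho>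
      using that smooth by (elim insertE emptyE) simp_all
  qed
qed

section \<open>From the curve to the splitting system\<close>

lemma kcubic_line_slope_inj:
  assumes "\<And>u. kcubic (\<lambda>j. \<xi> j + u) (a * u + b) = 0" "\<And>u. kcubic (\<lambda>j. \<xi> j + u) (a * u + c) = 0"
    and a: "a \<in> {2, 2 + sqrt 2, 2 - sqrt 2}"
  shows "b = c"
proof -
  \<comment> \<open>In terms of (a - 2)^2, which is 0 or 2, the factor of the offset is -2 or
    4.\<close>
  have "a = 2 \<or> (a - 2)^2 = 2" using a by auto
  moreover have "3 * a^2 - 12 * a + 10 = 3 * (a - 2)^2 - 2"
    by (simp add: power2_eq_square algebra_simps)
  ultimately have "3 * a^2 - 12 * a + 10 \<noteq> 0" by auto
  moreover have "(3 * a^2 - 12 * a + 10) * b = (3 * a^2 - 12 * a + 10) * c"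
    using kcubic_line_coeffs(1)[OF assms(1)] kcubic_line_coeffs(1)[OF assms(2)] by simp
  ultimately show ?thesis by simp
qed

lemma three_ellipses_imp_splitting_system:
  assumes K: "three_ellipses_and_origin (kippenhahn_curve A)"
    and poly: "\<And>l t. kippenhahn_poly A (complex_of_real l) t =
      complex_of_real (- (l * kcubic (\<lambda>j. \<xi> j + (cos t)^2) (l^2)))"
    and \<xi>: "\<And>j. j \<in> {1..6} \<Longrightarrow> \<xi> j \<ge> 0"
  shows "splitting_system \<xi>"
proof -
  let ?S = "{2, 2 + sqrt 2, 2 - sqrt 2}"
  obtain U \<zeta> \<eta> \<omega> where U: "open U" "U \<noteq> {}" "U \<subseteq> {0<..<pi/2}"
    and ord: "\<And>t. t \<in> U \<Longrightarrow> 0 < \<zeta> t \<and> \<zeta> t < \<eta> t \<and> \<eta> t < \<omega> t"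
    and root: "\<And>\<rho> t. \<rho> \<in> {\<zeta>, \<eta>, \<omega>} \<Longrightarrow> t \<in> U \<Longrightarrow> kcubic (\<lambda>j. \<xi> j + (cos t)^2) (\<rho> t) = 0"
    and smooth: "\<And>\<rho>. \<rho> \<in> {\<zeta>, \<eta>, \<omega>} \<Longrightarrow> \<exists>f' f''. \<forall>t\<in>U.
       ((\<lambda>t. sqrt (\<rho> t)) has_real_derivative f' t) (at t) \<and> (f' has_real_derivative f'' t) (at t)"
    using kcubic_smooth_roots[of \<xi>] \<xi> by blast
  have line: "\<exists>V a c. open V \<and> V \<noteq> {} \<and> V \<subseteq> W \<and> a \<in> ?S \<and>
      (\<forall>u. kcubic (\<lambda>j. \<xi> j + u) (a * u + c) = 0) \<and> (\<forall>t\<in>V. \<rho> t = a * (cos t)^2 + c)"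
    if \<rho>: "\<rho> \<in> {\<zeta>, \<eta>, \<omega>}" and W: "open W" "W \<noteq> {}" "W \<subseteq> U" for \<rho> W
  proof -
    have pos: "\<rho> t > 0" if "t \<in> U" for t
      using \<rho> ord[OF that] by auto
    obtain f' f'' where f: "\<And>t. t \<in> U \<Longrightarrow> ((\<lambda>t. sqrt (\<rho> t)) has_real_derivative f' t) (at t)"
      and f': "\<And>t. t \<in> U \<Longrightarrow> (f' has_real_derivative f'' t) (at t)"
      using smooth[OF \<rho>] by blast
    have on: "cis (- t) * Complex (sqrt (\<rho> t)) (- f' t) \<in> kippenhahn_curve A" if t: "t \<in> W" for t
    proof -
      have tU: "t \<in> U" using t W(3) by blast
      have "\<forall>\<^sub>F t in nhds t. t \<in> U"
        using U(1) tU by (rule eventually_nhds_in_open)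
      then have "kippenhahn_branch A (\<lambda>t. sqrt (\<rho> t)) t"
        unfolding kippenhahn_branch_def
      proof eventually_elim
        case (elim t)
        have "kcubic (\<lambda>j. \<xi> j + (cos t)^2) ((sqrt (\<rho> t))^2) = 0"
          using root[OF \<rho> elim] pos[OF elim] by simp
        then show ?case
          using f[OF elim] real_differentiable_def unfolding poly by auto
      qed
      moreover have "t \<in> {-pi<..pi}" using U(3) tU pi_gt_zero by fastforce
      moreover note envelope_point_iff[OF f[OF tU], of "cis (- t) * Complex (sqrt (\<rho> t)) (- f' t)"]
      ultimately show ?thesis unfolding kippenhahn_curve_def by blast
    qed
    have "\<exists>V \<alpha> \<beta> \<gamma>. open V \<and> V \<noteq> {} \<and> V \<subseteq> W \<and>
      (\<forall>t\<in>V. (sqrt (\<rho> t))^2 = \<alpha> * (cos t)^2 + \<beta> * (cos t * sin t) + \<gamma>)"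
      by (rule support_square_on_three_ellipses[OF K W(1,2), of _ f' f'']) (use W(3) f f' on in auto)
    then obtain V \<alpha> \<beta> \<gamma> where V: "open V" "V \<noteq> {}" "V \<subseteq> W"
      and sq: "\<And>t. t \<in> V \<Longrightarrow> (sqrt (\<rho> t))^2 = \<alpha> * (cos t)^2 + \<beta> * (cos t * sin t) + \<gamma>"
      by blast
    have VU: "V \<subseteq> U" using V(3) W(3) by blast
    have \<rho>_eq: "\<rho> t = \<alpha> * (cos t)^2 + \<beta> * (cos t * sin t) + \<gamma>" if "t \<in> V" for t
      using sq[OF that] pos[of t] VU that by auto
    have V': "V \<subseteq> {0<..<pi/2}" using VU U(3) by blast
    have "kcubic (\<lambda>j. \<xi> j + (cos t)^2) (\<alpha> * (cos t)^2 + \<beta> * (cos t * sin t) + \<gamma>) = 0" if "t \<in> V" for t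
      using root[OF \<rho>, of t] \<rho>_eq[OF that] VU that by auto
    note form = quadratic_form_roots[OF V(1,2) V' this]
    have "\<forall>t\<in>V. \<rho> t = \<alpha> * (cos t)^2 + \<gamma>"
      using \<rho>_eq form(1) by simp
    with V form(2,3) show ?thesis by blast
  qed
  obtain V1 a1 c1 where V1: "open V1" "V1 \<noteq> {}" "V1 \<subseteq> U" and 1: "a1 \<in> ?S"
    "\<And>u. kcubic (\<lambda>j. \<xi> j + u) (a1 * u + c1) = 0" "\<And>t. t \<in> V1 \<Longrightarrow> \<zeta> t = a1 * (cos t)^2 + c1"
    using line[of \<zeta> U] U by blast
  obtain V2 a2 c2 where V2: "open V2" "V2 \<noteq> {}" "V2 \<subseteq> V1" and 2: "a2 \<in> ?S"
    "\<And>u. kcubic (\<lambda>j. \<xi> j + u) (a2 * u + c2) = 0" "\<And>t. t \<in> V2 \<Longrightarrow> \<eta> t = a2 * (cos t)^2 + c2"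
    using line[of \<eta> V1] V1 by blast
  have "V2 \<subseteq> U" using V1 V2 by blast
  then obtain V3 a3 c3 where V3: "open V3" "V3 \<noteq> {}" "V3 \<subseteq> V2" and 3: "a3 \<in> ?S"
    "\<And>u. kcubic (\<lambda>j. \<xi> j + u) (a3 * u + c3) = 0" "\<And>t. t \<in> V3 \<Longrightarrow> \<omega> t = a3 * (cos t)^2 + c3"
    using line[of \<omega> V2] V2 by blast
  obtain t where t: "t \<in> V3" using V3 by blast
  then have "t \<in> V2" "t \<in> V1" "t \<in> U" using V1(3) V2(3) V3(3) by auto
  then have eqs: "\<zeta> t = a1 * (cos t)^2 + c1" "\<eta> t = a2 * (cos t)^2 + c2" "\<omega> t = a3 * (cos t)^2 + c3"
    using 1(3) 2(3) 3(3) t by simp_all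
  have lt: "\<zeta> t < \<eta> t" "\<eta> t < \<omega> t"
    using ord[OF \<open>t \<in> U\<close>] by simp_all
  \<comment> \<open>Equal slopes would have equal offsets, and two of the three roots would coincide
    at t. The nested sets V3, V2, V1 provide this common angle.\<close>
  have ne: "a1 \<noteq> a2" "a1 \<noteq> a3" "a2 \<noteq> a3"
    using kcubic_line_slope_inj[OF 1(2) _ 1(1), of c2] kcubic_line_slope_inj[OF 1(2) _ 1(1), of c3]
      kcubic_line_slope_inj[OF 2(2) _ 2(1), of c3] 2(2) 3(2) eqs lt by auto
  then have "card {a1, a2, a3} = 3" by simp
  moreover have "card ?S \<le> 3" by (simp add: card_insert_if)
  ultimately have "{a1, a2, a3} = ?S"
    using 1(1) 2(1) 3(1) by (intro card_seteq) auto
  then have "\<exists>c. \<forall>u. kcubic (\<lambda>j. \<xi> j + u) (a * u + c) = 0" if "a \<in> ?S" for a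
    using 1(2) 2(2) 3(2) that by (metis insertE emptyE)
  then obtain p q r where "\<And>u. kcubic (\<lambda>j. \<xi> j + u) (2 * u + p) = 0"
    "\<And>u. kcubic (\<lambda>j. \<xi> j + u) ((2 + sqrt 2) * u + q) = 0"
    "\<And>u. kcubic (\<lambda>j. \<xi> j + u) ((2 - sqrt 2) * u + r) = 0"
    by (meson insertCI)
  then show ?thesis by (rule kcubic_lines_imp_splitting_system)
qed

section \<open>The characterization\<close>

text \<open>No term of the alternating sum is positive for negative z. This will show that the
  offsets of the lines are nonnegative.\<close>

lemma kcubic_neg:
  assumes y: "\<And>j. j \<in> {1..6} \<Longrightarrow> y j \<ge> 0" and "z < 0"
  shows "kcubic y z < 0"
proof -
  have nonneg: "y 1 \<ge> 0" "y 2 \<ge> 0" "y 3 \<ge> 0" "y 4 \<ge> 0" "y 5 \<ge> 0" "y 6 \<ge> 0"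
    using y by simp_all
  have "path_e1 y \<ge> 0" "path_e2 y \<ge> 0" "path_e3 y \<ge> 0"
    unfolding path_e1_def path_e2_def path_e3_def using nonneg by simp_all
  then have "path_e1 y * z^2 \<ge> 0" "path_e2 y * z \<le> 0" "path_e3 y \<ge> 0"
    using \<open>z < 0\<close> by (simp_all add: mult_nonneg_nonpos)
  moreover have "z^3 < 0" using \<open>z < 0\<close> by (simp add: power_less_zero_eq)
  ultimately show ?thesis unfolding kcubic_def by linarith
qed

lemma splitting_system_imp_three_ellipses:
  assumes "splitting_system \<xi>"
    and poly: "\<And>l t. kippenhahn_poly A (complex_of_real l) t =
      complex_of_real (- (l * kcubic (\<lambda>j. \<xi> j + (cos t)^2) (l^2)))"
    and \<xi>: "\<And>j. j \<in> {1..6} \<Longrightarrow> \<xi> j \<ge> 0"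
  shows "three_ellipses_and_origin (kippenhahn_curve A)"
proof -
  define \<alpha> where "\<alpha> = (\<lambda>i::nat. if i = 0 then 2 else if i = 1 then 2 + sqrt 2 else 2 - sqrt 2)"
  define \<beta> where "\<beta> = (\<lambda>i::nat. if i = 0 then lone_offset \<xi>
    else if i = 1 then pair_mean \<xi> + sqrt 2 * pair_spread \<xi> else pair_mean \<xi> - sqrt 2 * pair_spread \<xi>)"
  have three: "(\<exists>i<3. P i) \<longleftrightarrow> P 0 \<or> P 1 \<or> P 2" for P :: "nat \<Rightarrow> bool"
    by (auto simp: numeral_3_eq_3 less_Suc_eq numeral_2_eq_2)
  have root: "kcubic (\<lambda>j. \<xi> j + u) z = 0 \<longleftrightarrow> (\<exists>i<3. z = \<alpha> i * u + \<beta> i)" for u z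
    unfolding splitting_system_imp_factorization[OF assms(1)] three \<alpha>_def \<beta>_def by auto
  show ?thesis
  proof (rule three_ellipses_if_roots)
    have "sqrt 2 < sqrt (2^2)" by (rule real_sqrt_less_mono) simp
    then show "\<alpha> i > 0" if "i < 3" for i
      by (simp add: \<alpha>_def add_pos_pos)
    \<comment> \<open>The offset is the root of the cubic at u = 0, where the weights are the \<xi>
      j themselves.\<close>
    show "\<beta> i \<ge> 0" if "i < 3" for i
    proof (rule ccontr)
      assume "\<not> \<beta> i \<ge> 0"
      then have "kcubic (\<lambda>j. \<xi> j + 0) (\<beta> i) < 0"
        using \<xi> by (intro kcubic_neg) simp_all
      moreover have "kcubic (\<lambda>j. \<xi> j + 0) (\<beta> i) = 0"
        unfolding root using that by auto
      ultimately show False by simp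
    qed
    show "inj_on \<alpha> {..<3}"
      by (rule inj_onI) (auto simp: \<alpha>_def split: if_splits)
    show "kippenhahn_poly A (complex_of_real l) t = 0 \<longleftrightarrow>
        l = 0 \<or> (\<exists>i<3. l^2 = \<alpha> i * (cos t)^2 + \<beta> i)" for l t
      unfolding poly root[symmetric] by simp
  qed
qed

theorem corollary2:
  fixes A :: "complex mat" and \<xi> :: "nat \<Rightarrow> real"
  assumes "A \<in> reciprocal_matrices 7"
    and "\<And>j. j \<in> {1..6} \<Longrightarrow> \<xi> j = (cmod (A $$ (j - 1, j)) - cmod (A $$ (j, j - 1)))^2 / 4"
  shows "three_ellipses_and_origin (kippenhahn_curve A) \<longleftrightarrow>
    (\<xi> 2^2 - \<xi> 3^2 - \<xi> 4^2 - \<xi> 5^2 - 2 * \<xi> 6^2 - 6 * \<xi> 3 * \<xi> 2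
        + 2 * \<xi> 4 * \<xi> 2 + 2 * \<xi> 5 * \<xi> 2 - 2 * \<xi> 3 * \<xi> 4 + 6 * \<xi> 3 * \<xi> 5
        - 2 * \<xi> 4 * \<xi> 5 + 4 * \<xi> 3 * \<xi> 6 + 4 * \<xi> 4 * \<xi> 6 - 4 * \<xi> 5 * \<xi> 6 = 0 \<and>
     \<xi> 1 + \<xi> 2 - \<xi> 5 - \<xi> 6 = 0)
    \<or>
    (\<xi> 2 + \<xi> 3 = \<xi> 4 + \<xi> 5 \<and>
     \<xi> 1^3 + 3 * \<xi> 2 * \<xi> 1^2 + 4 * \<xi> 3 * \<xi> 1^2 + 4 * \<xi> 4 * \<xi> 1^2
        + 3 * \<xi> 5 * \<xi> 1^2 + 3 * \<xi> 6 * \<xi> 1^2 + \<xi> 2^2 * \<xi> 1 + 2 * \<xi> 3^2 * \<xi> 1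
        + 2 * \<xi> 4^2 * \<xi> 1 + \<xi> 5^2 * \<xi> 1 + 3 * \<xi> 6^2 * \<xi> 1
        + 4 * \<xi> 2 * \<xi> 3 * \<xi> 1 + 4 * \<xi> 2 * \<xi> 4 * \<xi> 1
        + 4 * \<xi> 3 * \<xi> 4 * \<xi> 1 + 2 * \<xi> 2 * \<xi> 5 * \<xi> 1
        - 28 * \<xi> 3 * \<xi> 5 * \<xi> 1 + 4 * \<xi> 4 * \<xi> 5 * \<xi> 1
        + 6 * \<xi> 2 * \<xi> 6 * \<xi> 1 - 24 * \<xi> 3 * \<xi> 6 * \<xi> 1
        - 24 * \<xi> 4 * \<xi> 6 * \<xi> 1 + 6 * \<xi> 5 * \<xi> 6 * \<xi> 1 - \<xi> 2^3 - \<xi> 5^3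
        + \<xi> 6^3 + 2 * \<xi> 2 * \<xi> 3^2 + 2 * \<xi> 2 * \<xi> 4^2 - 3 * \<xi> 2 * \<xi> 5^2
        + 3 * \<xi> 2 * \<xi> 6^2 + 4 * \<xi> 3 * \<xi> 6^2 + 4 * \<xi> 4 * \<xi> 6^2
        + 3 * \<xi> 5 * \<xi> 6^2 + 4 * \<xi> 2 * \<xi> 3 * \<xi> 4 - 3 * \<xi> 2^2 * \<xi> 5
        + 2 * \<xi> 3^2 * \<xi> 5 + 2 * \<xi> 4^2 * \<xi> 5 + 4 * \<xi> 3 * \<xi> 4 * \<xi> 5
        + \<xi> 2^2 * \<xi> 6 + 2 * \<xi> 3^2 * \<xi> 6 + 2 * \<xi> 4^2 * \<xi> 6 + \<xi> 5^2 * \<xi> 6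
        + 4 * \<xi> 2 * \<xi> 3 * \<xi> 6 - 28 * \<xi> 2 * \<xi> 4 * \<xi> 6
        + 4 * \<xi> 3 * \<xi> 4 * \<xi> 6 + 2 * \<xi> 2 * \<xi> 5 * \<xi> 6
        + 4 * \<xi> 3 * \<xi> 5 * \<xi> 6 + 4 * \<xi> 4 * \<xi> 5 * \<xi> 6 = 0 \<and>
     5 * \<xi> 1^2 + 10 * \<xi> 2 * \<xi> 1 - 4 * \<xi> 3 * \<xi> 1 - 4 * \<xi> 4 * \<xi> 1
        - 6 * \<xi> 5 * \<xi> 1 - 6 * \<xi> 6 * \<xi> 1 + 3 * \<xi> 2^2 + 2 * \<xi> 3^2 + 2 * \<xi> 4^2
        + 3 * \<xi> 5^2 + 5 * \<xi> 6^2 + 8 * \<xi> 2 * \<xi> 3 - 8 * \<xi> 2 * \<xi> 4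
        + 4 * \<xi> 3 * \<xi> 4 - 10 * \<xi> 2 * \<xi> 5 - 8 * \<xi> 3 * \<xi> 5 + 8 * \<xi> 4 * \<xi> 5
        - 6 * \<xi> 2 * \<xi> 6 - 4 * \<xi> 3 * \<xi> 6 - 4 * \<xi> 4 * \<xi> 6 + 10 * \<xi> 5 * \<xi> 6 = 0)"
proof -
  let "_ \<longleftrightarrow> (?a1 = 0 \<and> ?a2 = 0) \<or> (?b = ?b' \<and> ?b1 = 0 \<and> ?b2 = 0)" = ?thesis
  have nonneg: "\<xi> j \<ge> 0" if "j \<in> {1..6}" for j
    unfolding assms(2)[OF that] by simp
  note poly = kippenhahn_poly_reciprocal[OF assms]
  have "three_ellipses_and_origin (kippenhahn_curve A) \<longleftrightarrow> splitting_system \<xi>"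
    using three_ellipses_imp_splitting_system[OF _ poly nonneg]
      splitting_system_imp_three_ellipses[OF _ poly nonneg] by blast
  also have "\<dots> \<longleftrightarrow> ?a2 * (?b - ?b') = 0 \<and> ?b1 = 0 \<and> ?b2 = 0"
  proof -
    define p m d where "p = lone_offset \<xi>" and "m = pair_mean \<xi>" and "d = pair_spread \<xi>"
    note defs = p_def m_def d_def lone_offset_def pair_mean_def pair_spread_def
    \<comment> \<open>The factors 16 here and 32 below clear the denominators 2, 4 and 4 of
      \<open>p\<close>, \<open>m\<close> and \<open>d\<close>.\<close>
    have b2: "?b2 = 16 * (2 * p * m + (m^2 - 2 * d^2) - path_e2 \<xi>)"
      unfolding defs path_e2_def by (simp add: power2_eq_square field_simps)
    have b1: "?b1 = 32 * (p * (m^2 - 2 * d^2) - path_e3 \<xi>)"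
      unfolding defs path_e3_def by (simp add: power2_eq_square power3_eq_cube field_simps)
    have ab: "?a2 * (?b - ?b') = (\<xi> 1 + \<xi> 2 - \<xi> 5 - \<xi> 6) * (\<xi> 2 + \<xi> 3 - \<xi> 4 - \<xi> 5)"
      by (simp add: algebra_simps)
    show ?thesis
      unfolding b1 b2 ab splitting_system_def p_def[symmetric] m_def[symmetric] d_def[symmetric]
      by auto
  qed
  also have "\<dots> \<longleftrightarrow> (?a1 = 0 \<and> ?a2 = 0) \<or> (?b = ?b' \<and> ?b1 = 0 \<and> ?b2 = 0)"
  proof (cases "?a2 = 0")
    case True
    then have \<xi>1: "\<xi> 1 = \<xi> 5 + \<xi> 6 - \<xi> 2" by simp
    \<comment> \<open>When \<xi> 1 + \<xi> 2 = \<xi> 5 + \<xi> 6, both equations of (b) are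
      multiples of the quadratic in (a), and the quadratic equation is itself a nonzero constant
      times one of them. So a single equation suffices in (a).\<close>
    have b2: "?b2 = - 2 * ?a1"
      unfolding \<xi>1 by (simp add: power2_eq_square algebra_simps)
    have b1: "?b1 = - 4 * (\<xi> 5 + \<xi> 6) * ?a1"
      unfolding \<xi>1 by (simp add: power2_eq_square power3_eq_cube algebra_simps)
    show ?thesis
      unfolding b1 b2 using True by auto
  next
    case False
    then show ?thesis by auto
  qed
  finally show ?thesis .
qed

end
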